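(* Assume the Setting below. Let $\boldsymbol s=(s_0,\dots,s_L)$ and $\boldsymbol B=(B_0,\dots,B_L)$ be given, with $\xi,\vartheta_l,r_l$ defined from them as below, and suppose $\sum_{l=0}^L r_l+\xi\to0$ and $n(\sum_{l=0}^L r_l+\xi)\to\infty$. Put $\epsilon_n=\sqrt{(\sum_{l=0}^L r_l+\xi)\sum_{l=0}^L u_l}$ and assume $\epsilon_n\to0$, $n\epsilon_n^2\to\infty$. Suppose that, for all large $n$: (i) (tests) there exist tests $\phi_n=\phi_n(\mathcal D)\in[0,1]$ and constants $C_1,C_2>0$ with $\mathbb E_{P_0^n}\phi_n\le e^{-C_1n\epsilon_n^2}$ and $\sup\{\mathbb E_{P_{\boldsymbol\theta}^n}(1-\phi_n):\boldsymbol\theta\in\mathcal H_{\epsilon_n}^c,\ \eta_{\boldsymbol\theta}\in\mathcal F(L,\boldsymbol k,\boldsymbol s^\circ,\boldsymbol B^\circ)\}\le e^{-C_2nd_H^2(P_0,P_{\boldsymbol\theta})}$ (the supremum understood pointwise in $\boldsymbol\theta$); (ii) (prior mass) $\widetilde\Pi(\mathcal F(L,\boldsymbol k,\boldsymbol s^\circ,\boldsymbol B^\circ)^c)\le\exp(-C_3n\epsilon_n^2/\sum_{l=0}^Lu_l)$ for some $C_3>0$; (iii) (KL conditions) for some constants $C_4,C_5>0$ and some $q\in\mathcal Q^{\rm MF}$: $\widetilde\Pi(\mathcal N_{\sum_l r_l+\xi})\ge\exp(-C_4n(\sum_l r_l+\xi))$ and $d_{KL}(q,\pi)+n\sum_{\boldsymbol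 z}\int d_{KL}(P_0,P_{\boldsymbol\theta})\,q(\boldsymbol\theta,\boldsymbol z)\,d\boldsymbol\theta\le C_5n(\sum_l r_l+\xi)$. Then there is a sequence $M_n\to\infty$ with $M_n\epsilon_n\to0$ such that $\widetilde\Pi^*(\mathcal H_{M_n\epsilon_n}^c)\to0$ in $P_0^n$-probability as $n\to\infty$.
   Context: Setting. Let $n$ be the sample size, $p\ge1$, depth $L\ge1$, widths $k_0=p,k_1,\dots,k_L\ge1$, $k_{L+1}=1$; $L$, the $k_l$ and all quantities below may depend on $n$, and limits are as $n\to\infty$. Let $\psi:\mathbb R\to\mathbb R$ be a 1-Lipschitz activation with $\psi(x)\le x$ for $x\ge0$, applied coordinatewise. For $\boldsymbol\theta=(\overline W_0,\dots,\overline W_L)$, $\overline W_l=(v_l,W_l)\in\mathbb R^{k_{l+1}\times(k_l+1)}$ ($v_l\in\mathbb R^{k_{l+1}}$, $W_l\in\mathbb R^{k_{l+1}\times k_l}$), define $\eta_{\boldsymbol\theta}(x)=v_L+W_L\psi(v_{L-1}+W_{L-1}\psi(\cdots\psi(v_1+W_1\psi(v_0+W_0x))))$. Let $\overline w_{lj}\in\mathbb R^{k_l+1}$ be the $j$-th row of $\overline W_l$ and $\widetilde w_l=(\|\overline w_{l1}\|_1,\dots,\|\overline w_{lk_{l+1}}\|_1)$. Data $\mathcal D=\{(x_i,y_i)\}_{i=1}^n$ are i.i.d. with $x_i\sim U[0,1]^p$ and $y_i=\eta_0(x_i)+e_i$, $e_i\sim N(0,1)$ independent of $x_i$, for an unknown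 $\eta_0:[0,1]^p\to\mathbb R$. $P_0$ is the density $f_0(y,x)=(2\pi)^{-1/2}e^{-(y-\eta_0(x))^2/2}$ on $\mathbb R\times[0,1]^p$, $P_{\boldsymbol\theta}$ the density $f_{\boldsymbol\theta}(y,x)=(2\pi)^{-1/2}e^{-(y-\eta_{\boldsymbol\theta}(x))^2/2}$, $P_0^n=\prod_if_0(y_i,x_i)$, $P_{\boldsymbol\theta}^n=\prod_if_{\boldsymbol\theta}(y_i,x_i)$ (also the corresponding product laws). $d_H^2(P_0,P_{\boldsymbol\theta})=\frac12\int(\sqrt{f_{\boldsymbol\theta}}-\sqrt{f_0})^2\,dy\,dx$, $d_{KL}(P_0,P_{\boldsymbol\theta})=\int f_0\log(f_0/f_{\boldsymbol\theta})\,dy\,dx$; $\mathcal H_\varepsilon=\{\boldsymbol\theta:d_H(P_0,P_{\boldsymbol\theta})\le\varepsilon\}$, $\mathcal N_\varepsilon=\{\boldsymbol\theta:d_{KL}(P_0,P_{\boldsymbol\theta})<\varepsilon\}$. Prior $\pi$ on $(\boldsymbol\theta,\boldsymbol z)$: node indicators $z_{lj}$ ($l=0,\dots,L$, $j=1,\dots,k_{l+1}$) independent ${\rm Bernoulli}(\lambda_l)$ with $\lambda_L=1$; given $\boldsymbol z$, the rows are independent with $\overline w_{lj}\mid z_{lj}\sim(1-z_{lj})\delta_{\boldsymbol 0}+z_{lj}N(0,\sigma_0^2I_{k_l+1})$, $\sigma_0^2=1$. $\widetilde\pi(\boldsymbol\theta)=\sum_{\boldsymbol z}\pi(\boldsymbol\theta,\boldsymbol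 z)$ is the marginal prior of $\boldsymbol\theta$ with law $\widetilde\Pi$. The posterior is $\pi(\boldsymbol\theta,\boldsymbol z\mid\mathcal D)\propto P_{\boldsymbol\theta}^n\pi(\boldsymbol\theta,\boldsymbol z)$. The mean-field family $\mathcal Q^{\rm MF}$ consists of laws of $(\boldsymbol\theta,\boldsymbol z)$ with $z_{lj}$ independent ${\rm Bernoulli}(\gamma_{lj})$, $\gamma_{Lj}=1$, and, given $\boldsymbol z$, independent rows $\overline w_{lj}\mid z_{lj}\sim(1-z_{lj})\delta_{\boldsymbol 0}+z_{lj}N(\boldsymbol\mu_{lj},{\rm diag}(\boldsymbol\sigma_{lj}^2))$. The variational posterior is $\pi^*=\arg\min_{q\in\mathcal Q^{\rm MF}}d_{KL}(q,\pi(\cdot\mid\mathcal D))$, $\widetilde\pi^*(\boldsymbol\theta)=\sum_{\boldsymbol z}\pi^*(\boldsymbol\theta,\boldsymbol z)$ with law $\widetilde\Pi^*$. Sieve: for $\boldsymbol s=(s_0,\dots,s_L)$, $\boldsymbol B=(B_0,\dots,B_L)$, $\mathcal F(L,\boldsymbol k,\boldsymbol s,\boldsymbol B)=\{\eta_{\boldsymbol\theta}:\|\widetilde w_l\|_0\le s_l,\ \|\widetilde w_l\|_\infty\le B_l,\ l=0,\dots,L\}$ ($\|\cdot\|_0$ = number of nonzero entries). Let $u_l=(L+1)^2(\log n+\log(L+1)+\log k_{l+1}+\log(k_l+1))$. For a sequence $\epsilon_n$, $\boldsymbol s^\circ,\boldsymbol B^\circ$ are given by $s_l^\circ+1=n\epsilon_n^2/\sum_{j=0}^Lu_j$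 and $\log B_l^\circ=n\epsilon_n^2/((L+1)\sum_{j=0}^L(s_j^\circ+1))$. For given $\boldsymbol s,\boldsymbol B$: $\xi=\min_{\eta_{\boldsymbol\theta}\in\mathcal F(L,\boldsymbol k,\boldsymbol s,\boldsymbol B)}\|\eta_{\boldsymbol\theta}-\eta_0\|_\infty^2$ (sup over $[0,1]^p$), $\vartheta_l=B_l^2/(k_l+1)+\sum_{m\ne l}\log B_m+L+\log k_{l+1}+\log(k_l+1)+\log n+\log(\sum_{m=0}^Lu_m)$, and $r_l=s_l(k_l+1)\vartheta_l/n$. *)

theory Defs
  imports "HOL-Probability.Probability"
begin

type_synonym params = "nat \<times> nat \<times> nat \<Rightarrow> real"
  \<comment> \<open>entry (l,j,i): layer l, row j, column i of the augmented matrix (v_l, W_l);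
      column 0 is the bias v_l, column i+1 is column i of W_l\<close>
type_synonym nodes = "nat \<times> nat \<Rightarrow> bool"
type_synonym inp = "nat \<Rightarrow> real"
type_synonym obs = "real \<times> (nat \<Rightarrow> real)"

definition unit_cube :: "nat \<Rightarrow> inp set" where
  "unit_cube p = PiE {..<p} (\<lambda>_. {0..1})"

definition input_space :: "nat \<Rightarrow> inp measure" where
  "input_space p = PiM {..<p} (\<lambda>_. lborel)"

definition obs_space :: "nat \<Rightarrow> obs measure" where
  "obs_space p = lborel \<Otimes>\<^sub>M input_space p"

definition data_space :: "nat \<Rightarrow> nat \<Rightarrow> (nat \<Rightarrow> obs) measure" where
  "data_space p n = PiM {..<n} (\<lambda>_. obs_space p)"

definition sample_law :: "nat \<Rightarrow> 'a measure \<Rightarrow> (nat \<Rightarrow> 'a) measure" where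
  "sample_law n P = PiM {..<n} (\<lambda>_. P)"

definition affine :: "(nat \<Rightarrow> nat) \<Rightarrow> params \<Rightarrow> nat \<Rightarrow> (nat \<Rightarrow> real) \<Rightarrow> nat \<Rightarrow> real" where
  "affine k \<theta> l h j = \<theta> (l, j, 0) + (\<Sum>i<k l. \<theta> (l, j, Suc i) * h i)"

fun hidden :: "(real \<Rightarrow> real) \<Rightarrow> (nat \<Rightarrow> nat) \<Rightarrow> params \<Rightarrow> inp \<Rightarrow> nat \<Rightarrow> nat \<Rightarrow> real" where
  "hidden \<psi> k \<theta> x 0 = x"
| "hidden \<psi> k \<theta> x (Suc l) = (\<lambda>j. \<psi> (affine k \<theta> l (hidden \<psi> k \<theta> x l) j))"

definition dnn :: "(real \<Rightarrow> real) \<Rightarrow> nat \<Rightarrow> (nat \<Rightarrow> nat) \<Rightarrow> params \<Rightarrow> inp \<Rightarrow> real" where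
  "dnn \<psi> L k \<theta> x = affine k \<theta> L (hidden \<psi> k \<theta> x L) 0"

definition param_set :: "nat \<Rightarrow> (nat \<Rightarrow> nat) \<Rightarrow> (nat \<times> nat \<times> nat) set" where
  "param_set L k = {(l, j, i). l \<le> L \<and> j < k (Suc l) \<and> i \<le> k l}"

definition node_set :: "nat \<Rightarrow> (nat \<Rightarrow> nat) \<Rightarrow> (nat \<times> nat) set" where
  "node_set L k = {(l, j). l \<le> L \<and> j < k (Suc l)}"

definition param_space :: "nat \<Rightarrow> (nat \<Rightarrow> nat) \<Rightarrow> params measure" where
  "param_space L k = PiM (param_set L k) (\<lambda>_. lborel)"

definition indicator_set :: "nat \<Rightarrow> (nat \<Rightarrow> nat) \<Rightarrow> nodes set" where
  "indicator_set L k = PiE (node_set L k) (\<lambda>_. UNIV)"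

definition joint_space :: "nat \<Rightarrow> (nat \<Rightarrow> nat) \<Rightarrow> (nodes \<times> params) measure" where
  "joint_space L k = count_space (indicator_set L k) \<Otimes>\<^sub>M param_space L k"

definition row_l1 :: "(nat \<Rightarrow> nat) \<Rightarrow> params \<Rightarrow> nat \<Rightarrow> nat \<Rightarrow> real" where
  "row_l1 k \<theta> l j = (\<Sum>i\<le>k l. \<bar>\<theta> (l, j, i)\<bar>)"

definition in_sieve :: "nat \<Rightarrow> (nat \<Rightarrow> nat) \<Rightarrow> (nat \<Rightarrow> real) \<Rightarrow> (nat \<Rightarrow> real) \<Rightarrow> params \<Rightarrow> bool" where
  "in_sieve L k s B \<theta> \<longleftrightarrow>
     (\<forall>l\<le>L. real (card {j. j < k (Suc l) \<and> row_l1 k \<theta> l j \<noteq> 0}) \<le> s l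
            \<and> (\<forall>j<k (Suc l). row_l1 k \<theta> l j \<le> B l))"

definition sieve :: "(real \<Rightarrow> real) \<Rightarrow> nat \<Rightarrow> nat \<Rightarrow> (nat \<Rightarrow> nat) \<Rightarrow> (nat \<Rightarrow> real) \<Rightarrow> (nat \<Rightarrow> real)
                      \<Rightarrow> (inp \<Rightarrow> real) set" where
  "sieve \<psi> p L k s B = {restrict (dnn \<psi> L k \<theta>) (unit_cube p) | \<theta>.
       \<theta> \<in> space (param_space L k) \<and> in_sieve L k s B \<theta>}"

definition approx_err :: "(real \<Rightarrow> real) \<Rightarrow> nat \<Rightarrow> nat \<Rightarrow> (nat \<Rightarrow> nat) \<Rightarrow> (nat \<Rightarrow> real) \<Rightarrow> (nat \<Rightarrow> real)
                           \<Rightarrow> (inp \<Rightarrow> real) \<Rightarrow> ereal" where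
  "approx_err \<psi> p L k s B \<eta>0 =
     (INF \<theta>\<in>{\<theta>\<in>space (param_space L k). in_sieve L k s B \<theta>}.
        (SUP x\<in>unit_cube p. ereal \<bar>dnn \<psi> L k \<theta> x - \<eta>0 x\<bar>) ^ 2)"

definition u_term :: "nat \<Rightarrow> (nat \<Rightarrow> nat) \<Rightarrow> nat \<Rightarrow> nat \<Rightarrow> real" where
  "u_term L k n l = (real L + 1)^2 * (ln (real n) + ln (real L + 1) + ln (real (k (Suc l))) + ln (real (k l) + 1))"

definition vartheta :: "nat \<Rightarrow> (nat \<Rightarrow> nat) \<Rightarrow> (nat \<Rightarrow> real) \<Rightarrow> nat \<Rightarrow> nat \<Rightarrow> real" where
  "vartheta L k B n l = (B l)^2 / (real (k l) + 1) + (\<Sum>m\<in>{..L} - {l}. ln (B m)) + real L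
      + ln (real (k (Suc l))) + ln (real (k l) + 1) + ln (real n) + ln (\<Sum>m\<le>L. u_term L k n m)"

definition r_term :: "nat \<Rightarrow> (nat \<Rightarrow> nat) \<Rightarrow> (nat \<Rightarrow> real) \<Rightarrow> (nat \<Rightarrow> real) \<Rightarrow> nat \<Rightarrow> nat \<Rightarrow> real" where
  "r_term L k s B n l = s l * (real (k l) + 1) * vartheta L k B n l / real n"


definition U_sum :: "nat \<Rightarrow> (nat \<Rightarrow> nat) \<Rightarrow> nat \<Rightarrow> real" where
  "U_sum L k n = (\<Sum>l\<le>L. u_term L k n l)"

definition R_sum :: "nat \<Rightarrow> (nat \<Rightarrow> nat) \<Rightarrow> (nat \<Rightarrow> real) \<Rightarrow> (nat \<Rightarrow> real) \<Rightarrow> nat \<Rightarrow> real" where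
  "R_sum L k s B n = (\<Sum>l\<le>L. r_term L k s B n l)"

definition xi_val :: "(real \<Rightarrow> real) \<Rightarrow> nat \<Rightarrow> nat \<Rightarrow> (nat \<Rightarrow> nat) \<Rightarrow> (nat \<Rightarrow> real) \<Rightarrow> (nat \<Rightarrow> real)
                       \<Rightarrow> (inp \<Rightarrow> real) \<Rightarrow> real" where
  "xi_val \<psi> p L k s B \<eta>0 = real_of_ereal (approx_err \<psi> p L k s B \<eta>0)"

definition eps_rate :: "(real \<Rightarrow> real) \<Rightarrow> nat \<Rightarrow> nat \<Rightarrow> (nat \<Rightarrow> nat) \<Rightarrow> (nat \<Rightarrow> real) \<Rightarrow> (nat \<Rightarrow> real)
                       \<Rightarrow> (inp \<Rightarrow> real) \<Rightarrow> nat \<Rightarrow> real" where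
  "eps_rate \<psi> p L k s B \<eta>0 n = sqrt ((R_sum L k s B n + xi_val \<psi> p L k s B \<eta>0) * U_sum L k n)"

definition s_circ :: "nat \<Rightarrow> (nat \<Rightarrow> nat) \<Rightarrow> nat \<Rightarrow> real \<Rightarrow> nat \<Rightarrow> real" where
  "s_circ L k n \<epsilon> l = real n * \<epsilon>\<^sup>2 / U_sum L k n - 1"

definition B_circ :: "nat \<Rightarrow> (nat \<Rightarrow> nat) \<Rightarrow> nat \<Rightarrow> real \<Rightarrow> nat \<Rightarrow> real" where
  "B_circ L k n \<epsilon> l = exp (real n * \<epsilon>\<^sup>2 / ((real L + 1) * (\<Sum>j\<le>L. s_circ L k n \<epsilon> j + 1)))"

definition reg_density :: "nat \<Rightarrow> (inp \<Rightarrow> real) \<Rightarrow> obs \<Rightarrow> real" where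
  "reg_density p \<eta> = (\<lambda>(y, x). indicator (unit_cube p) x * normal_density (\<eta> x) 1 y)"

definition reg_model :: "nat \<Rightarrow> (inp \<Rightarrow> real) \<Rightarrow> obs measure" where
  "reg_model p \<eta> = density (obs_space p) (\<lambda>z. ennreal (reg_density p \<eta> z))"

definition hellinger :: "'a measure \<Rightarrow> ('a \<Rightarrow> real) \<Rightarrow> ('a \<Rightarrow> real) \<Rightarrow> real" where
  "hellinger M f g = sqrt (enn2real ((\<integral>\<^sup>+ z. ennreal ((sqrt (f z) - sqrt (g z))^2) \<partial>M) / 2))"

definition kl_div :: "'a measure \<Rightarrow> 'a measure \<Rightarrow> ennreal" where
  "kl_div Q P = (if sets Q = sets P \<and> absolutely_continuous P Q
                     \<and> integrable Q (\<lambda>x. ln (enn2real (RN_deriv P Q x)))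
                 then ennreal (\<integral>x. ln (enn2real (RN_deriv P Q x)) \<partial>Q) else \<infinity>)"

definition mixture :: "nat \<Rightarrow> (nat \<Rightarrow> nat) \<Rightarrow> (nodes \<Rightarrow> real) \<Rightarrow> (nodes \<Rightarrow> params measure)
                        \<Rightarrow> (nodes \<times> params) measure" where
  "mixture L k w K = measure_of (space (joint_space L k)) (sets (joint_space L k))
     (\<lambda>A. \<Sum>z\<in>indicator_set L k. ennreal (w z) *
            emeasure (K z) {\<theta> \<in> space (param_space L k). (z, \<theta>) \<in> A})"

definition spike_slab :: "nat \<Rightarrow> (nat \<Rightarrow> nat) \<Rightarrow> params \<Rightarrow> params \<Rightarrow> nodes \<Rightarrow> params measure" where
  "spike_slab L k \<mu> \<sigma> z = PiM (param_set L k) (\<lambda>(l, j, i).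
      if z (l, j) then density lborel (normal_density (\<mu> (l, j, i)) (\<sigma> (l, j, i)))
      else return lborel 0)"

definition bern_weight :: "nat \<Rightarrow> (nat \<Rightarrow> nat) \<Rightarrow> (nat \<times> nat \<Rightarrow> real) \<Rightarrow> nodes \<Rightarrow> real" where
  "bern_weight L k \<gamma> z = (\<Prod>lj\<in>node_set L k. if z lj then \<gamma> lj else 1 - \<gamma> lj)"

definition nn_prior :: "nat \<Rightarrow> (nat \<Rightarrow> nat) \<Rightarrow> (nat \<Rightarrow> real) \<Rightarrow> (nodes \<times> params) measure" where
  "nn_prior L k lam = mixture L k (bern_weight L k (\<lambda>(l, j). lam l)) (spike_slab L k (\<lambda>_. 0) (\<lambda>_. 1))"

definition mean_field :: "nat \<Rightarrow> (nat \<Rightarrow> nat) \<Rightarrow> (nodes \<times> params) measure set" where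
  "mean_field L k = {mixture L k (bern_weight L k \<gamma>) (spike_slab L k \<mu> \<sigma>) | \<gamma> \<mu> \<sigma>.
       (\<forall>l j. 0 \<le> \<gamma> (l, j) \<and> \<gamma> (l, j) \<le> 1) \<and> (\<forall>j. \<gamma> (L, j) = 1) \<and> (\<forall>\<iota>. 0 < \<sigma> \<iota>)}"

definition likelihood :: "(real \<Rightarrow> real) \<Rightarrow> nat \<Rightarrow> nat \<Rightarrow> (nat \<Rightarrow> nat) \<Rightarrow> nat \<Rightarrow> params
                           \<Rightarrow> (nat \<Rightarrow> obs) \<Rightarrow> real" where
  "likelihood \<psi> p L k n \<theta> D = (\<Prod>i<n. reg_density p (dnn \<psi> L k \<theta>) (D i))"

definition nn_posterior :: "(real \<Rightarrow> real) \<Rightarrow> nat \<Rightarrow> nat \<Rightarrow> (nat \<Rightarrow> nat) \<Rightarrow> (nat \<Rightarrow> real) \<Rightarrow> nat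
                             \<Rightarrow> (nat \<Rightarrow> obs) \<Rightarrow> (nodes \<times> params) measure" where
  "nn_posterior \<psi> p L k lam n D =
     density (nn_prior L k lam)
       (\<lambda>w. ennreal (likelihood \<psi> p L k n (snd w) D) /
            (\<integral>\<^sup>+ w'. ennreal (likelihood \<psi> p L k n (snd w') D) \<partial>nn_prior L k lam))"

text \<open>Outer probability (used so that no measurability of events is presupposed).\<close>
definition outer_prob :: "'a measure \<Rightarrow> 'a set \<Rightarrow> real" where
  "outer_prob M S = Inf {measure M A | A. A \<in> sets M \<and> S \<inter> space M \<subseteq> A}"

end

(*
  The sequence M is free apart from M -> infinity and M eps -> 0, so the claim is consistency of the
  variational posterior: by a diagonal argument it suffices that its mass of {dH > c} tends to 0 for
  each fixed c. The regression residuals provide an exponentially powerful test of {dH > c} which is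
  uniform over all regression functions: E exp(-(y - eta0 x)^2 / 2) equals 1 / sqrt 2 under the truth
  and is at most (1 - c^2) / sqrt 2 as soon as dH > c. The Donsker-Varadhan inequality applied to the
  variational optimum with the test function kappa n 1_{dH > c} bounds kappa n Pi*(dH > c) by the
  objective value of the competitor q of the KL condition plus the logarithm of
  int LR dpi + e^(kappa n) int_{dH > c} LR dpi, which is bounded in probability when the test accepts.
  The right-hand side is of order n (R + xi) = o(n).
*)
theory Submission
  imports Defs
begin

section \<open>Entropy inequalities for variational approximations\<close>

text \<open>The usual obstacle is a lower bound for the evidence Z. Here Z enters twice: ln Z is
  part of the competitor's divergence to the posterior, and Z divides the posterior mass of the far
  set. The two merge into ln (Z + e^t N), where N is the prior integral of the likelihood ratio over
  that set. Only upper bounds on Z and N remain, and they follow from Markov's inequality because a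
  likelihood ratio has mean 1 under the truth. One test serves every alternative because the mean of
  the kernel under a regression function \<eta> is a Gaussian convolution in \<eta> - \<eta>0, which
  is largest at 0. Every deviation lowers it, so no covering of the parameter set occurs. Its decay
  exp (-t/4), with t the squared deviation, lies below the Hellinger affinity exp (-t/8), and this
  ties the drop of the mean to dH. With the radius c fixed, the gain is linear in n, so thresholds
  of order n are affordable and crude estimates suffice. The map from the data to the variational
  optimum need not be measurable. The exceptional data set is therefore built from likelihood ratios
  alone, before any optimum is named.\<close>

lemma kl_div_density:
  assumes P: "prob_space P" and D[measurable]: "D \<in> borel_measurable P" and D0: "\<And>x. 0 \<le> D x"
    and QD: "Q = density P (\<lambda>x. ennreal (D x))"
  shows "kl_div Q P = (if integrable Q (\<lambda>x. ln (D x)) then ennreal (\<integral>x. ln (D x) \<partial>Q) else \<infinity>)"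
proof -
  interpret P: prob_space P by fact
  have sets: "sets Q = sets P" by (simp add: QD)
  have ac: "absolutely_continuous P Q"
    unfolding QD by (rule absolutely_continuousI_density) simp
  \<comment> \<open>The derivative is determined only up to P-null sets. These are Q-null as well,
    so any nonnegative version of the density may replace it in integrals over Q.\<close>
  have "AE x in P. ennreal (D x) = RN_deriv P Q x"
    by (rule P.RN_deriv_unique) (auto simp: QD)
  then have "AE x in Q. ennreal (D x) = RN_deriv P Q x"
    unfolding QD by (subst AE_density) auto
  then have ae: "AE x in Q. ln (enn2real (RN_deriv P Q x)) = ln (D x)"
    by eventually_elim (metis D0 enn2real_ennreal)
  have "integrable Q (\<lambda>x. ln (enn2real (RN_deriv P Q x))) \<longleftrightarrow> integrable Q (\<lambda>x. ln (D x))"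
    by (rule integrable_cong_AE) (use ae sets in \<open>simp_all cong: measurable_cong_sets\<close>)
  moreover have "(\<integral>x. ln (enn2real (RN_deriv P Q x)) \<partial>Q) = (\<integral>x. ln (D x) \<partial>Q)"
    by (rule integral_cong_AE) (use ae sets in \<open>simp_all cong: measurable_cong_sets\<close>)
  ultimately show ?thesis by (simp add: kl_div_def sets ac)
qed

text \<open>A divergence is infinite by default, so finiteness alone yields a density with
  integrable logarithm. It is positive Q-almost everywhere because Q does not charge its zero set.
  The variational optimum is known only through its objective value, and this is how it acquires a
  density.\<close>

lemma kl_div_finiteE:
  assumes P: "prob_space P" and Q: "finite_measure Q" and fin: "kl_div Q P < \<infinity>"
  obtains D where "D \<in> borel_measurable P" "\<And>x. 0 \<le> D x" "Q = density P (\<lambda>x. ennreal (D x))"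
    "AE x in Q. 0 < D x" "integrable Q (\<lambda>x. ln (D x))" "kl_div Q P = ennreal (\<integral>x. ln (D x) \<partial>Q)"
proof -
  interpret P: prob_space P by fact
  have ac: "sets Q = sets P" "absolutely_continuous P Q"
    using fin by (auto simp: kl_div_def split: if_splits)
  obtain D where D: "D \<in> borel_measurable P" "AE x in P. RN_deriv P Q x = ennreal (D x)"
    "AE x in Q. 0 < D x" "\<And>x. 0 \<le> D x"
    using P.real_RN_deriv[OF Q ac(2,1)] by blast
  have "Q = density P (RN_deriv P Q)"
    using P.density_RN_deriv[OF ac(2,1)] by simp
  also have "\<dots> = density P (\<lambda>x. ennreal (D x))"
    by (rule density_cong) (use D in auto)
  finally have QD: "Q = density P (\<lambda>x. ennreal (D x))" .
  have "integrable Q (\<lambda>x. ln (D x))" "kl_div Q P = ennreal (\<integral>x. ln (D x) \<partial>Q)"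
    using kl_div_density[OF P D(1) D(4) QD] fin by (auto split: if_splits)
  with D QD that show ?thesis by blast
qed

text \<open>Integrating the tangent-line bound \<open>ln u \<le> u / c - 1 + ln c\<close> for \<open>u = e\<^sup>f / D\<close>
  and \<open>c \<ge> \<integral>e\<^sup>f dP\<close>, where \<open>f = t 1\<^sub>A\<close>.\<close>

lemma event_bound_by_entropy:
  assumes P: "prob_space P" and Q: "prob_space Q" and D[measurable]: "D \<in> borel_measurable P"
    and QD: "Q = density P (\<lambda>x. ennreal (D x))"
    and Dpos: "AE x in Q. 0 < D x" and int: "integrable Q (\<lambda>x. ln (D x))"
    and A[measurable]: "A \<in> sets P" and t: "0 \<le> t"
  shows "t * measure Q A \<le> (\<integral>x. ln (D x) \<partial>Q) + ln (1 + exp t * measure P A)"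
proof -
  interpret P: prob_space P by fact
  interpret Q: prob_space Q by fact
  have sets[measurable_cong]: "sets Q = sets P" by (simp add: QD)
  define F :: "_ \<Rightarrow> real" where "F x = exp (t * indicator A x)" for x
  define c where "c = 1 + exp t * measure P A"
  have c1: "1 \<le> c" by (simp add: c_def)
  have [measurable]: "F \<in> borel_measurable P" unfolding F_def by measurable
  have Fle: "F x \<le> 1 + exp t * indicator A x" for x
    by (auto simp: F_def indicator_def)
  have "(\<integral>\<^sup>+x. ennreal (F x / D x) \<partial>Q) = (\<integral>\<^sup>+x. ennreal (D x) * ennreal (F x / D x) \<partial>P)"
    unfolding QD by (rule nn_integral_density) auto
  \<comment> \<open>Where \<open>D x\<close> is not positive the left integrand is 0, so going back
    from Q to P may lose mass. Only this upper bound is used.\<close>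
  also have "\<dots> \<le> (\<integral>\<^sup>+x. ennreal (1 + exp t * indicator A x) \<partial>P)"
  proof (rule nn_integral_mono)
    fix x
    show "ennreal (D x) * ennreal (F x / D x) \<le> ennreal (1 + exp t * indicator A x)"
    proof (cases "0 < D x")
      case True
      then have "ennreal (D x) * ennreal (F x / D x) = ennreal (F x)"
        by (subst ennreal_mult'[symmetric]) auto
      then show ?thesis using ennreal_leI[OF Fle[of x]] by simp
    next
      case False
      then have "ennreal (D x) = 0" by (simp add: ennreal_neg)
      then show ?thesis by simp
    qed
  qed
  also have "\<dots> = ennreal c"
  proof -
    have "(\<integral>x. 1 + exp t * indicator A x \<partial>P) = c"
      by (subst Bochner_Integration.integral_add) (auto simp: c_def P.prob_space less_top[symmetric])
    moreover have "integrable P (\<lambda>x. 1 + exp t * indicator A x)"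
      by (intro Bochner_Integration.integrable_add) (auto simp: less_top[symmetric])
    ultimately show ?thesis
      by (subst nn_integral_eq_integral) auto
  qed
  finally have le: "(\<integral>\<^sup>+x. ennreal (F x / D x) \<partial>Q) \<le> ennreal c" .
  have [measurable]: "(\<lambda>x. F x / D x) \<in> borel_measurable Q" by measurable
  have pos: "AE x in Q. 0 \<le> F x / D x"
    using Dpos by eventually_elim (simp add: F_def)
  have iF: "integrable Q (\<lambda>x. F x / D x)"
    by (rule integrableI_nonneg) (use le pos in \<open>auto simp: top.not_eq_extremum intro: le_less_trans\<close>)
  have "ennreal (\<integral>x. F x / D x \<partial>Q) \<le> ennreal c"
    using le nn_integral_eq_integral[OF iF pos] by simp
  then have Fc: "(\<integral>x. F x / D x \<partial>Q) \<le> c" using c1 by simp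
  have i1: "integrable Q (\<lambda>x. t * indicator A x - ln (D x))"
    using int by (intro Bochner_Integration.integrable_diff) (auto simp: less_top[symmetric])
  have i2: "integrable Q (\<lambda>x. (F x / D x) / c - 1 + ln c)"
    by (intro Bochner_Integration.integrable_add Bochner_Integration.integrable_diff
        integrable_divide_zero iF) auto
  have "t * measure Q A - (\<integral>x. ln (D x) \<partial>Q) = (\<integral>x. t * indicator A x - ln (D x) \<partial>Q)"
    using int by (subst Bochner_Integration.integral_diff) (auto simp: less_top[symmetric] sets)
  also have "\<dots> \<le> (\<integral>x. (F x / D x) / c - 1 + ln c \<partial>Q)"
  proof (rule integral_mono_AE[OF i1 i2])
    show "AE x in Q. t * indicator A x - ln (D x) \<le> F x / D x / c - 1 + ln c"
      using Dpos
    proof eventually_elim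
      case (elim x)
      have "ln (F x / D x / c) \<le> F x / D x / c - 1"
        using elim c1 by (intro ln_le_minus_one) (simp add: F_def)
      moreover have "ln (F x / D x / c) = t * indicator A x - ln (D x) - ln c"
        using elim c1 by (simp add: F_def ln_div ln_mult)
      ultimately show ?case by simp
    qed
  qed
  also have "\<dots> = (\<integral>x. F x / D x \<partial>Q) / c - 1 + ln c"
    using iF by (simp add: Q.prob_space del: divide_divide_eq_left)
  also have "\<dots> \<le> ln c"
    using Fc c1 by (simp add: field_simps)
  finally show ?thesis by (simp add: c_def)
qed

text \<open>With P as prior and \<open>g\<close> as likelihood, the tilted law is the posterior. The
  chain rule for densities splits the divergence to it into the divergence to the prior, the
  expected log-likelihood and the log-evidence.\<close>

lemma kl_div_tilted:
  assumes P: "prob_space P" and D[measurable]: "D \<in> borel_measurable P" and D0: "\<And>x. 0 \<le> D x"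
    and QD: "Q = density P (\<lambda>x. ennreal (D x))"
    and Q: "prob_space Q" and Dpos: "AE x in Q. 0 < D x" and int: "integrable Q (\<lambda>x. ln (D x))"
    and g[measurable]: "g \<in> borel_measurable P" and gpos: "\<forall>x\<in>space P. 0 < g x"
    and gint: "integrable P g" and lg: "integrable Q (\<lambda>x. ln (g x))"
  defines "Z \<equiv> (\<integral>x. g x \<partial>P)"
  shows "prob_space (density P (\<lambda>x. ennreal (g x / Z)))" (is "prob_space ?P'")
    and "0 < Z"
    and "kl_div Q (density P (\<lambda>x. ennreal (g x / Z)))
           = ennreal ((\<integral>x. ln (D x) \<partial>Q) - (\<integral>x. ln (g x) \<partial>Q) + ln Z)"
    and "0 \<le> (\<integral>x. ln (D x) \<partial>Q) - (\<integral>x. ln (g x) \<partial>Q) + ln Z"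
proof -
  interpret P: prob_space P by fact
  interpret Q: prob_space Q by fact
  have sets[measurable_cong]: "sets Q = sets P" by (simp add: QD)
  have "Z \<noteq> 0"
  proof
    assume "Z = 0"
    then have "AE x in P. g x = 0"
      using integral_nonneg_eq_0_iff_AE[OF gint] gpos unfolding Z_def by (auto simp: less_imp_le)
    moreover have "AE x in P. g x \<noteq> 0" using gpos by (intro AE_I2) fastforce
    ultimately have "AE x in P. False" by eventually_elim simp
    then show False using P.not_empty by (simp add: P.AE_False)
  qed
  moreover have "0 \<le> Z" unfolding Z_def
    by (intro integral_nonneg_AE AE_I2) (simp add: gpos less_imp_le)
  ultimately show Zpos: "0 < Z" by simp
  have gz: "integrable P (\<lambda>x. g x / Z)" using gint by simp
  have gz0: "AE x in P. 0 \<le> g x / Z" using gpos Zpos by (intro AE_I2) (simp add: less_imp_le)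
  show P': "prob_space ?P'"
  proof
    have "emeasure ?P' (space ?P') = (\<integral>\<^sup>+x. ennreal (g x / Z) \<partial>P)"
      by (simp add: emeasure_density cong: nn_integral_cong)
    also have "\<dots> = ennreal (\<integral>x. g x / Z \<partial>P)"
      by (rule nn_integral_eq_integral[OF gz gz0])
    also have "(\<integral>x. g x / Z \<partial>P) = 1" using Zpos by (simp add: Z_def)
    finally show "emeasure ?P' (space ?P') = 1" by simp
  qed
  \<comment> \<open>The absolute value makes \<open>D'\<close> nonnegative everywhere, also outside
    the space of P, where the sign of \<open>g\<close> is unknown.\<close>
  define D' where "D' x = D x * Z / \<bar>g x\<bar>" for x
  have [measurable]: "D' \<in> borel_measurable ?P'" unfolding D'_def by measurable
  have D'0: "0 \<le> D' x" for x using D0 Zpos by (simp add: D'_def)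
  have QD': "Q = density ?P' (\<lambda>x. ennreal (D' x))"
  proof -
    have "density ?P' (\<lambda>x. ennreal (D' x)) = density P (\<lambda>x. ennreal (g x / Z) * ennreal (D' x))"
      by (rule density_density_eq) (auto simp: D'_def)
    also have "\<dots> = density P (\<lambda>x. ennreal (D x))"
    proof (rule density_cong)
      show "AE x in P. ennreal (g x / Z) * ennreal (D' x) = ennreal (D x)"
      proof (rule AE_I2)
        fix x assume "x \<in> space P"
        then have "0 < g x" using gpos by blast
        then show "ennreal (g x / Z) * ennreal (D' x) = ennreal (D x)"
          using Zpos D0 by (subst ennreal_mult'[symmetric]) (auto simp: D'_def)
      qed
    qed (auto simp: D'_def)
    finally show ?thesis by (simp add: QD)
  qed
  have spQ: "space Q = space P" using sets by (rule sets_eq_imp_space_eq)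
  have gQ: "AE x in Q. 0 < g x" using gpos by (intro AE_I2) (simp add: spQ)
  have ae: "AE x in Q. ln (D' x) = ln (D x) - ln (g x) + ln Z"
    using Dpos gQ
    by eventually_elim (use Zpos in \<open>simp add: D'_def ln_div ln_mult\<close>)
  have D'pos: "AE x in Q. 0 < D' x"
    using Dpos gQ by eventually_elim (use Zpos in \<open>simp add: D'_def\<close>)
  have iD': "integrable Q (\<lambda>x. ln (D' x)) \<longleftrightarrow> integrable Q (\<lambda>x. ln (D x) - ln (g x) + ln Z)"
    by (rule integrable_cong_AE) (use ae in \<open>auto simp: D'_def\<close>)
  then have iD'': "integrable Q (\<lambda>x. ln (D' x))"
    using int lg by auto
  have eq: "(\<integral>x. ln (D' x) \<partial>Q) = (\<integral>x. ln (D x) - ln (g x) + ln Z \<partial>Q)"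
    by (rule integral_cong_AE) (use ae in \<open>auto simp: D'_def\<close>)
  also have eq': "\<dots> = (\<integral>x. ln (D x) \<partial>Q) - (\<integral>x. ln (g x) \<partial>Q) + ln Z"
    using int lg by (simp add: Q.prob_space)
  finally have val: "(\<integral>x. ln (D' x) \<partial>Q) = (\<integral>x. ln (D x) \<partial>Q) - (\<integral>x. ln (g x) \<partial>Q) + ln Z" .
  show "kl_div Q ?P' = ennreal ((\<integral>x. ln (D x) \<partial>Q) - (\<integral>x. ln (g x) \<partial>Q) + ln Z)"
    using kl_div_density[OF P' _ D'0 QD'] iD'' val by simp
  \<comment> \<open>Gibbs' inequality, as the case of the empty event and t = 0. It is recorded
    because \<open>ennreal\<close> truncates at 0: without it, comparing divergences would not
    compare the real values.\<close>
  show "0 \<le> (\<integral>x. ln (D x) \<partial>Q) - (\<integral>x. ln (g x) \<partial>Q) + ln Z"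
    using event_bound_by_entropy[OF P' Q _ QD' D'pos iD'', of "{}" 0] val by simp
qed

text \<open>Optimality transfers the objective value of Q to Q', and the entropy bound is then
  applied with the posterior as base measure. Apart from the event itself nothing about Q' survives
  on the right. The ln Z of the objective value is absorbed into the logarithm of the event
  term.\<close>

lemma variational_event_bound:
  assumes P: "prob_space P" and D[measurable]: "D \<in> borel_measurable P" and D0: "\<And>x. 0 \<le> D x"
    and QD: "Q = density P (\<lambda>x. ennreal (D x))"
    and Q: "prob_space Q" and Dpos: "AE x in Q. 0 < D x" and int: "integrable Q (\<lambda>x. ln (D x))"
    and g[measurable]: "g \<in> borel_measurable P" and gpos: "\<forall>x\<in>space P. 0 < g x"
    and gint: "integrable P g" and lg: "integrable Q (\<lambda>x. ln (g x))"
    and Z: "Z = (\<integral>x. g x \<partial>P)"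
    and Q': "prob_space Q'"
    and opt: "kl_div Q' (density P (\<lambda>x. ennreal (g x / Z))) \<le> kl_div Q (density P (\<lambda>x. ennreal (g x / Z)))"
    and A[measurable]: "A \<in> sets P" and t: "0 \<le> t"
  shows "t * measure Q' A \<le> (\<integral>x. ln (D x) \<partial>Q) - (\<integral>x. ln (g x) \<partial>Q)
            + ln (Z + exp t * (\<integral>x. indicator A x * g x \<partial>P))"
proof -
  note T = kl_div_tilted[OF P D D0 QD Q Dpos int g gpos gint lg, folded Z]
  interpret P: prob_space P by fact
  let ?P' = "density P (\<lambda>x. ennreal (g x / Z))"
  define v where "v = (\<integral>x. ln (D x) \<partial>Q) - (\<integral>x. ln (g x) \<partial>Q) + ln Z"
  have fin: "kl_div Q' ?P' \<le> ennreal v" using opt T(3) by (simp add: v_def)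
  then have "kl_div Q' ?P' < \<infinity>" by (simp add: le_less_trans)
  then obtain E where E: "E \<in> borel_measurable ?P'" "\<And>x. 0 \<le> E x" "Q' = density ?P' (\<lambda>x. ennreal (E x))"
    "AE x in Q'. 0 < E x" "integrable Q' (\<lambda>x. ln (E x))" "kl_div Q' ?P' = ennreal (\<integral>x. ln (E x) \<partial>Q')"
    using kl_div_finiteE[OF T(1) prob_space.finite_measure[OF Q']] by metis
  have "(\<integral>x. ln (E x) \<partial>Q') \<le> v"
    using fin T(4) E(6) by (simp add: v_def)
  moreover have "t * measure Q' A \<le> (\<integral>x. ln (E x) \<partial>Q') + ln (1 + exp t * measure ?P' A)"
    by (rule event_bound_by_entropy[OF T(1) Q' E(1,3,4,5)]) (use t in auto)
  moreover have "measure ?P' A = (\<integral>x. indicator A x * g x \<partial>P) / Z"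
  proof -
    have i: "integrable P (\<lambda>x. indicator A x * g x / Z)"
      using integrable_real_mult_indicator[OF A gint] by (simp add: mult.commute)
    have "emeasure ?P' A = (\<integral>\<^sup>+x. ennreal (indicator A x * g x / Z) \<partial>P)"
      by (subst emeasure_density) (auto intro!: nn_integral_cong simp: indicator_def)
    also have "\<dots> = ennreal (\<integral>x. indicator A x * g x / Z \<partial>P)"
      using T(2) gpos by (intro nn_integral_eq_integral i AE_I2) (auto simp: less_imp_le indicator_def)
    moreover have "0 \<le> (\<integral>x. indicator A x * g x / Z \<partial>P)"
      using T(2) gpos by (intro integral_nonneg_AE AE_I2) (auto simp: less_imp_le indicator_def)
    ultimately have "measure ?P' A = (\<integral>x. indicator A x * g x / Z \<partial>P)"
      unfolding measure_def by simp
    then show ?thesis by simp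
  qed
  moreover have "ln (1 + exp t * ((\<integral>x. indicator A x * g x \<partial>P) / Z)) + ln Z
      = ln (Z + exp t * (\<integral>x. indicator A x * g x \<partial>P))"
  proof -
    have "0 \<le> (\<integral>x. indicator A x * g x \<partial>P)"
      using gpos by (intro integral_nonneg_AE AE_I2) (auto simp: less_imp_le indicator_def)
    then have "0 < 1 + exp t * ((\<integral>x. indicator A x * g x \<partial>P) / Z)"
      using T(2) by (auto intro!: add_pos_nonneg)
    then have "ln (1 + exp t * ((\<integral>x. indicator A x * g x \<partial>P) / Z)) + ln Z
       = ln ((1 + exp t * ((\<integral>x. indicator A x * g x \<partial>P) / Z)) * Z)"
      using T(2) by (simp add: ln_mult)
    also have "(1 + exp t * ((\<integral>x. indicator A x * g x \<partial>P) / Z)) * Z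
        = Z + exp t * (\<integral>x. indicator A x * g x \<partial>P)"
      using T(2) by (simp add: distrib_right)
    finally show ?thesis .
  qed
  ultimately show ?thesis by (simp add: v_def)
qed

section \<open>Variational posteriors under an exponentially powerful test\<close>

lemma exp_le_quadratic:
  fixes x :: real
  assumes "\<bar>x\<bar> \<le> 1"
  shows "exp x \<le> 1 + x + x\<^sup>2"
proof (cases "0 \<le> x")
  case True
  then show ?thesis using assms exp_bound[of x] by simp
next
  case False
  define y where "y = - x"
  have y: "0 < y" using False by (simp add: y_def)
  have "exp x = 1 / exp y" by (simp add: y_def exp_minus field_simps)
  also have "\<dots> \<le> 1 / (1 + y)"
    using y exp_ge_add_one_self[of y] by (intro divide_left_mono) (auto simp: add.commute)
  also have "\<dots> \<le> 1 - y + y\<^sup>2"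
  proof -
    have "(1 - y + y\<^sup>2) * (1 + y) = 1 + y ^ 3"
      by (simp add: algebra_simps power2_eq_square power3_eq_cube)
    then show ?thesis using y by (simp add: pos_divide_le_eq)
  qed
  finally show ?thesis by (simp add: y_def)
qed

text \<open>One factor of a Chernoff bound. The quadratic bound for exp costs
  \<open>l\<^sup>2\<close> because w lies in [0, 1]. The density \<open>r\<close> lets the same
  estimate serve under an alternative (\<open>r\<close> a likelihood ratio) and under the truth
  (\<open>r\<close> = 1, with 1 - w in place of w).\<close>

lemma nn_integral_exp_le:
  assumes r[measurable]: "r \<in> borel_measurable M" and w[measurable]: "w \<in> borel_measurable M"
    and r0: "\<And>x. x \<in> space M \<Longrightarrow> 0 \<le> r x" and w01: "\<And>x. x \<in> space M \<Longrightarrow> 0 \<le> w x \<and> w x \<le> 1"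
    and r1: "(\<integral>\<^sup>+x. ennreal (r x) \<partial>M) = 1"
    and mu: "(\<integral>\<^sup>+x. ennreal (r x * w x) \<partial>M) \<le> ennreal \<mu>" "0 \<le> \<mu>"
    and l: "0 \<le> l" "l \<le> 1"
  shows "(\<integral>\<^sup>+x. ennreal (r x * exp (l * (w x - m))) \<partial>M) \<le> ennreal (exp (l * (\<mu> - m) + l\<^sup>2))"
proof -
  let ?a = "exp (- l * m) * (1 + l\<^sup>2)" and ?b = "exp (- l * m) * l"
  have "(\<integral>\<^sup>+x. ennreal (r x * exp (l * (w x - m))) \<partial>M)
      \<le> (\<integral>\<^sup>+x. ennreal ?a * ennreal (r x) + ennreal ?b * ennreal (r x * w x) \<partial>M)"
  proof (rule nn_integral_mono)
    fix x assume x: "x \<in> space M"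
    have w: "0 \<le> w x" "w x \<le> 1" and r: "0 \<le> r x" using w01 r0 x by auto
    have lw: "0 \<le> l * w x" "l * w x \<le> 1" using w l by (auto intro: mult_le_one)
    have "(l * w x)\<^sup>2 \<le> l\<^sup>2"
      using w l by (intro power_mono) (auto intro: mult_left_le)
    then have "exp (l * w x) \<le> 1 + l * w x + l\<^sup>2"
      using exp_le_quadratic[of "l * w x"] lw by simp
    then have "exp (- l * m) * exp (l * w x) \<le> exp (- l * m) * (1 + l * w x + l\<^sup>2)"
      by simp
    then have "exp (l * (w x - m)) \<le> ?a + ?b * w x"
      by (simp add: exp_add[symmetric] algebra_simps)
    then have "r x * exp (l * (w x - m)) \<le> r x * (?a + ?b * w x)"
      using r by (rule mult_left_mono)
    also have "\<dots> = ?a * r x + ?b * (r x * w x)" by (simp add: algebra_simps)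
    finally have "ennreal (r x * exp (l * (w x - m))) \<le> ennreal (?a * r x + ?b * (r x * w x))"
      by (rule ennreal_leI)
    also have "\<dots> = ennreal (?a * r x) + ennreal (?b * (r x * w x))"
      using w r l by (intro ennreal_plus) auto
    also have "\<dots> = ennreal ?a * ennreal (r x) + ennreal ?b * ennreal (r x * w x)"
      using l by (simp add: ennreal_mult')
    finally show "ennreal (r x * exp (l * (w x - m)))
        \<le> ennreal ?a * ennreal (r x) + ennreal ?b * ennreal (r x * w x)" .
  qed
  also have "\<dots> = ennreal ?a + ennreal ?b * (\<integral>\<^sup>+x. ennreal (r x * w x) \<partial>M)"
    by (simp add: nn_integral_add nn_integral_cmult r1)
  also have "\<dots> \<le> ennreal ?a + ennreal ?b * ennreal \<mu>"
    by (intro add_left_mono mult_left_mono mu) auto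
  also have "\<dots> = ennreal (?a + ?b * \<mu>)"
    using l mu(2) by (simp add: ennreal_plus ennreal_mult')
  also have "\<dots> \<le> ennreal (exp (l * (\<mu> - m) + l\<^sup>2))"
  proof (rule ennreal_leI)
    have "?a + ?b * \<mu> = exp (- l * m) * (1 + (l * \<mu> + l\<^sup>2))" by (simp add: algebra_simps)
    also have "\<dots> \<le> exp (- l * m) * exp (l * \<mu> + l\<^sup>2)"
      by (intro mult_left_mono exp_ge_add_one_self) auto
    finally show "?a + ?b * \<mu> \<le> exp (l * (\<mu> - m) + l\<^sup>2)"
      by (simp add: exp_add[symmetric] algebra_simps)
  qed
  finally show ?thesis .
qed

text \<open>Since ln x \<le> x / 2, the function x - ln x is nonnegative and dominates |ln x|.
  Integrability of \<open>LR - ln LR\<close> therefore passes to ln \<open>LR\<close>.\<close>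

lemma diff_ln_ge:
  fixes x :: real
  assumes "0 < x"
  shows "x / 2 \<le> x - ln x" and "\<bar>ln x\<bar> \<le> 3 * (x - ln x)"
proof -
  have "ln (x / 2) \<le> x / 2 - 1" using assms by (intro ln_le_minus_one) simp
  moreover have "ln (2::real) \<le> 1" using ln_le_minus_one[of 2] by simp
  ultimately show *: "x / 2 \<le> x - ln x" using assms by (simp add: ln_div)
  show "\<bar>ln x\<bar> \<le> 3 * (x - ln x)" using * assms by (simp add: abs_le_iff)
qed

lemma ennreal_one_plus_le: "ennreal (1 + x) \<le> ennreal 1 + ennreal x"
proof (cases "0 \<le> x")
  case False
  then have "ennreal (1 + x) \<le> ennreal 1" by (intro ennreal_leI) simp
  then show ?thesis using False by (simp add: ennreal_neg)
qed (simp add: ennreal_plus)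

text \<open>T is the prior, q the competitor with density \<open>dq\<close> against it, \<rho> the
  likelihood ratio of one observation against the truth, and w a bounded statistic whose mean drops
  by at least 2 d on all of A. \<open>kl\<close> is merely a bound for the mean negative log-ratio
  and may be non-measurable. The condition d \<le> 2 makes d / 2 an admissible exponent, and 2 d
  \<le> \<mu> keeps the mean \<mu> - 2 d nonnegative.\<close>

locale separated_model =
  P0: prob_space P0 + T: prob_space T + q: prob_space q
  for P0 :: "'a measure" and T q :: "'b measure" +
  fixes \<rho> :: "'b \<Rightarrow> 'a \<Rightarrow> real" and kl :: "'b \<Rightarrow> ennreal" and dq :: "'b \<Rightarrow> real"
    and w :: "'a \<Rightarrow> real" and A :: "'b set" and \<mu> d :: real and n :: nat
  assumes rho_meas[measurable]: "(\<lambda>(b, a). \<rho> b a) \<in> borel_measurable (T \<Otimes>\<^sub>M P0)"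
    and rho_pos: "b \<in> space T \<Longrightarrow> a \<in> space P0 \<Longrightarrow> 0 < \<rho> b a"
    and rho_int: "b \<in> space T \<Longrightarrow> (\<integral>\<^sup>+a. ennreal (\<rho> b a) \<partial>P0) = 1"
    and kl: "b \<in> space T \<Longrightarrow> kl b < \<infinity> \<Longrightarrow> integrable P0 (\<lambda>a. ln (\<rho> b a))"
            "b \<in> space T \<Longrightarrow> kl b < \<infinity> \<Longrightarrow> ennreal (- (\<integral>a. ln (\<rho> b a) \<partial>P0)) \<le> kl b"
    and dq_meas[measurable]: "dq \<in> borel_measurable T" and dq0: "\<And>b. 0 \<le> dq b"
    and q_eq: "q = density T (\<lambda>b. ennreal (dq b))"
    and dq_pos: "AE b in q. 0 < dq b" and dq_int: "integrable q (\<lambda>b. ln (dq b))"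
    and w_meas[measurable]: "w \<in> borel_measurable P0" and w01: "\<And>a. 0 \<le> w a \<and> w a \<le> 1"
    and w_null: "(\<integral>\<^sup>+a. ennreal (w a) \<partial>P0) = ennreal \<mu>"
    and w_alt: "b \<in> A \<Longrightarrow> (\<integral>\<^sup>+a. ennreal (\<rho> b a * w a) \<partial>P0) \<le> ennreal (\<mu> - 2 * d)"
    and A_meas[measurable]: "A \<in> sets T" and mu: "2 * d \<le> \<mu>" and d: "0 < d" "d \<le> 2"
    and n: "1 \<le> n"
begin

definition "S = PiM {..<n} (\<lambda>_. P0)"
definition "LR b D = (\<Prod>i<n. \<rho> b (D i))"
text \<open>\<open>W \<ge> 1\<close> is the acceptance region of the test; \<open>W\<close> is the exponential factor
  by which Chernoff's bound is proved.\<close>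

definition "W D = (\<Prod>i<n. exp (d / 2 * (w (D i) - (\<mu> - d))))"
text \<open>The threshold \<mu> - d lies midway between the two means, so both error exponents have
  the form l d - l^2. It is maximal at l = d / 2, the factor used in W, with value d^2 / 4.\<close>

definition "\<kappa> = d\<^sup>2 / 4"

sublocale S: prob_space S
  unfolding S_def by (intro prob_space_PiM P0.prob_space_axioms)

sublocale prod: product_sigma_finite "\<lambda>_::nat. P0" ..

lemma sets_q[measurable_cong]: "sets q = sets T" by (simp add: q_eq)

lemma space_q: "space q = space T" by (simp add: q_eq)

lemma component[measurable]: "i < n \<Longrightarrow> (\<lambda>D. D i) \<in> measurable S P0"
  unfolding S_def by simp

lemma space_S: "D \<in> space S \<Longrightarrow> i < n \<Longrightarrow> D i \<in> space P0"
  by (auto simp: S_def space_PiM)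

lemma LR_meas[measurable]: "(\<lambda>(b, D). LR b D) \<in> borel_measurable (T \<Otimes>\<^sub>M S)"
proof -
  have "(\<lambda>x. \<rho> (fst x) (snd x i)) \<in> borel_measurable (T \<Otimes>\<^sub>M S)" if i: "i < n" for i
  proof -
    have "(\<lambda>x. (fst x, snd x i)) \<in> measurable (T \<Otimes>\<^sub>M S) (T \<Otimes>\<^sub>M P0)"
      using component[OF i] by measurable
    from measurable_compose[OF this rho_meas] show ?thesis by simp
  qed
  then show ?thesis unfolding LR_def split_beta by (intro borel_measurable_prod) auto
qed

lemma W_meas[measurable]: "W \<in> borel_measurable S"
  unfolding W_def by measurable

lemma rho_meas1: "b \<in> space T \<Longrightarrow> \<rho> b \<in> borel_measurable P0"
  using measurable_compose[OF measurable_Pair1' rho_meas] by simp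

lemma LR_meas1: "b \<in> space T \<Longrightarrow> LR b \<in> borel_measurable S"
  using measurable_compose[OF measurable_Pair1' LR_meas] by simp

lemma LR_meas2: "D \<in> space S \<Longrightarrow> (\<lambda>b. LR b D) \<in> borel_measurable T"
  using measurable_compose[OF measurable_Pair2' LR_meas] by simp

lemma LR_pos: "b \<in> space T \<Longrightarrow> D \<in> space S \<Longrightarrow> 0 < LR b D"
  unfolding LR_def by (intro prod_pos ballI rho_pos space_S) auto

lemma W_pos: "0 < W D"
  unfolding W_def by (intro prod_pos) auto

section \<open>Integrals of the likelihood ratio and of the test factor under the truth\<close>

lemma nn_integral_S_prod:
  assumes [measurable]: "f \<in> borel_measurable P0" and "\<And>a. a \<in> space P0 \<Longrightarrow> 0 \<le> f a"
  shows "(\<integral>\<^sup>+D. ennreal (\<Prod>i<n. f (D i)) \<partial>S) = (\<integral>\<^sup>+a. ennreal (f a) \<partial>P0) ^ n"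
proof -
  have "(\<integral>\<^sup>+D. ennreal (\<Prod>i<n. f (D i)) \<partial>S) = (\<integral>\<^sup>+D. (\<Prod>i<n. ennreal (f (D i))) \<partial>S)"
    using assms(2) space_S by (intro nn_integral_cong prod_ennreal[symmetric]) auto
  also have "\<dots> = (\<Prod>i<n. \<integral>\<^sup>+a. ennreal (f a) \<partial>P0)"
    unfolding S_def by (rule prod.product_nn_integral_prod) auto
  finally show ?thesis by simp
qed

lemma LR_int: "b \<in> space T \<Longrightarrow> (\<integral>\<^sup>+D. ennreal (LR b D) \<partial>S) = 1"
  unfolding LR_def
  by (subst nn_integral_S_prod) (auto simp: rho_meas1 rho_int intro: less_imp_le rho_pos)

text \<open>Error of the second kind, with the factor W in place of the indicator of acceptance, so
  that the integral is a product over the observations. Only the drop of the mean enters, whence the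
  uniformity over A.\<close>

lemma W_LR_int:
  assumes b: "b \<in> A"
  shows "(\<integral>\<^sup>+D. ennreal (W D * LR b D) \<partial>S) \<le> ennreal (exp (- real n * \<kappa>))"
proof -
  have bT: "b \<in> space T" using b A_meas sets.sets_into_space by blast
  note [measurable] = rho_meas1[OF bT]
  have "(\<integral>\<^sup>+D. ennreal (W D * LR b D) \<partial>S)
      = (\<integral>\<^sup>+D. ennreal (\<Prod>i<n. \<rho> b (D i) * exp (d / 2 * (w (D i) - (\<mu> - d)))) \<partial>S)"
    by (simp add: W_def LR_def prod.distrib mult.commute)
  also have "\<dots> = (\<integral>\<^sup>+a. ennreal (\<rho> b a * exp (d / 2 * (w a - (\<mu> - d)))) \<partial>P0) ^ n"
    by (rule nn_integral_S_prod) (auto intro!: mult_nonneg_nonneg less_imp_le[OF rho_pos] bT)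
  also have "\<dots> \<le> ennreal (exp (d / 2 * ((\<mu> - 2 * d) - (\<mu> - d)) + (d / 2)\<^sup>2)) ^ n"
    by (intro power_mono nn_integral_exp_le)
      (use bT w01 w_alt[OF b] d mu in \<open>auto intro: less_imp_le rho_pos simp: rho_int\<close>)
  also have "d / 2 * ((\<mu> - 2 * d) - (\<mu> - d)) + (d / 2)\<^sup>2 = - \<kappa>"
    by (simp add: \<kappa>_def power2_eq_square field_simps)
  finally show ?thesis
    by (simp add: ennreal_power exp_of_nat_mult[symmetric])
qed

text \<open>Error of the first kind: rejection means 1 / W > 1. The inverse of W is the same kind of
  product with 1 - w, of mean 1 - \<mu>, in place of w. That this mean is nonnegative follows from w
  \<le> 1.\<close>

lemma W_inverse_int: "(\<integral>\<^sup>+D. ennreal (1 / W D) \<partial>S) \<le> ennreal (exp (- real n * \<kappa>))"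
proof -
  have mu1: "\<mu> \<le> 1"
  proof -
    have "ennreal \<mu> \<le> (\<integral>\<^sup>+a. 1 \<partial>P0)"
      unfolding w_null[symmetric] using w01 by (intro nn_integral_mono) simp
    then show ?thesis by (simp add: P0.emeasure_space_1)
  qed
  have "integrable P0 w"
    using w01 by (intro P0.integrable_const_bound[where B=1]) auto
  moreover from this have "(\<integral>a. w a \<partial>P0) = \<mu>"
    using w_null w01 mu d by (subst (asm) nn_integral_eq_integral) auto
  ultimately have mean: "(\<integral>\<^sup>+a. ennreal (1 - w a) \<partial>P0) = ennreal (1 - \<mu>)"
    using w01 by (subst nn_integral_eq_integral) (auto simp: P0.prob_space)
  have "(\<integral>\<^sup>+D. ennreal (1 / W D) \<partial>S)
      = (\<integral>\<^sup>+D. ennreal (\<Prod>i<n. 1 * exp (d / 2 * ((1 - w (D i)) - (1 - (\<mu> - d))))) \<partial>S)"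
    by (simp add: W_def prod_inversef[symmetric] exp_minus[symmetric] inverse_eq_divide[symmetric] algebra_simps)
  also have "\<dots> = (\<integral>\<^sup>+a. ennreal (1 * exp (d / 2 * ((1 - w a) - (1 - (\<mu> - d))))) \<partial>P0) ^ n"
    by (rule nn_integral_S_prod) auto
  also have "\<dots> \<le> ennreal (exp (d / 2 * ((1 - \<mu>) - (1 - (\<mu> - d))) + (d / 2)\<^sup>2)) ^ n"
    by (intro power_mono nn_integral_exp_le)
      (use w01 d mu1 in \<open>auto simp: mean P0.emeasure_space_1\<close>)
  also have "d / 2 * ((1 - \<mu>) - (1 - (\<mu> - d))) + (d / 2)\<^sup>2 = - \<kappa>"
    by (simp add: \<kappa>_def power2_eq_square field_simps)
  finally show ?thesis
    by (simp add: ennreal_power exp_of_nat_mult[symmetric])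
qed

text \<open>The likelihood ratio has mean 1, and its logarithm is a sum of n identically distributed
  terms.\<close>

lemma LR_diff_ln_int:
  assumes b: "b \<in> space T"
  shows "(\<integral>\<^sup>+D. ennreal (LR b D - ln (LR b D)) \<partial>S) \<le> of_nat n * kl b + 1"
proof (cases "kl b < \<infinity>")
  case False
  \<comment> \<open>Here n \<ge> 1 matters, since 0 times infinity is 0.\<close>
  then have "of_nat n * kl b + 1 = \<infinity>"
    using n by (simp add: less_top[symmetric] ennreal_mult_eq_top_iff)
  then show ?thesis by simp
next
  case True
  note [measurable] = rho_meas1[OF b] LR_meas1[OF b]
  note k = kl[OF b True]
  have comp: "distr S P0 (\<lambda>D. D i) = P0" if "i < n" for i
    unfolding S_def using that by (intro distr_PiM_component P0.prob_space_axioms) auto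
  have i: "integrable S (\<lambda>D. ln (\<rho> b (D i)))"
       "(\<integral>D. ln (\<rho> b (D i)) \<partial>S) = (\<integral>a. ln (\<rho> b a) \<partial>P0)" if "i < n" for i
  proof -
    have "integrable (distr S P0 (\<lambda>D. D i)) (\<lambda>a. ln (\<rho> b a))"
      using k(1) comp[OF that] by simp
    then show "integrable S (\<lambda>D. ln (\<rho> b (D i)))"
      by (rule integrable_distr[OF component[OF that]])
    have "(\<integral>a. ln (\<rho> b a) \<partial>P0) = (\<integral>a. ln (\<rho> b a) \<partial>distr S P0 (\<lambda>D. D i))"
      using comp[OF that] by simp
    also have "\<dots> = (\<integral>D. ln (\<rho> b (D i)) \<partial>S)"
      by (rule integral_distr[OF component[OF that]]) measurable
    finally show "(\<integral>D. ln (\<rho> b (D i)) \<partial>S) = (\<integral>a. ln (\<rho> b a) \<partial>P0)" by simp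
  qed
  have lnLR: "ln (LR b D) = (\<Sum>i<n. ln (\<rho> b (D i)))" if "D \<in> space S" for D
    unfolding LR_def by (rule ln_prod) (use rho_pos[OF b] space_S[OF that] in \<open>force+\<close>)
  have iln: "integrable S (\<lambda>D. ln (LR b D))"
    by (subst Bochner_Integration.integrable_cong[OF refl lnLR]) (use i in auto)
  have vln: "(\<integral>D. ln (LR b D) \<partial>S) = real n * (\<integral>a. ln (\<rho> b a) \<partial>P0)"
  proof -
    have "(\<integral>D. ln (LR b D) \<partial>S) = (\<integral>D. (\<Sum>i<n. ln (\<rho> b (D i))) \<partial>S)"
      by (intro Bochner_Integration.integral_cong lnLR) auto
    also have "\<dots> = (\<Sum>i<n. (\<integral>D. ln (\<rho> b (D i)) \<partial>S))"
      by (rule Bochner_Integration.integral_sum) (use i in auto)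
    finally show ?thesis using i by simp
  qed
  have nn: "AE D in S. 0 \<le> LR b D"
    using LR_pos[OF b] by (intro AE_I2) (auto simp: less_imp_le)
  have iLR: "integrable S (LR b)"
    using LR_int[OF b] by (intro integrableI_nonneg nn) auto
  have vLR: "(\<integral>D. LR b D \<partial>S) = 1"
    using nn_integral_eq_integral[OF iLR nn] LR_int[OF b] by simp
  have "(\<integral>\<^sup>+D. ennreal (LR b D - ln (LR b D)) \<partial>S) = ennreal (\<integral>D. LR b D - ln (LR b D) \<partial>S)"
  proof (rule nn_integral_eq_integral)
    show "integrable S (\<lambda>D. LR b D - ln (LR b D))" using iLR iln by simp
    show "AE D in S. 0 \<le> LR b D - ln (LR b D)"
    proof (rule AE_I2)
      fix D assume "D \<in> space S"
      then show "0 \<le> LR b D - ln (LR b D)" using diff_ln_ge(1)[OF LR_pos[OF b]] LR_pos[OF b]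
        by (smt (verit) half_gt_zero)
    qed
  qed
  also have "(\<integral>D. LR b D - ln (LR b D) \<partial>S) = 1 + real n * - (\<integral>a. ln (\<rho> b a) \<partial>P0)"
    using iLR iln by (simp add: vLR vln)
  \<comment> \<open>Splitting off the 1 as an inequality avoids settling the sign of the mean
    log-ratio: truncation at 0 can only enlarge the right side.\<close>
  also have "ennreal (1 + real n * - (\<integral>a. ln (\<rho> b a) \<partial>P0))
      \<le> ennreal 1 + ennreal (real n * - (\<integral>a. ln (\<rho> b a) \<partial>P0))"
    by (rule ennreal_one_plus_le)
  also have "ennreal (real n * - (\<integral>a. ln (\<rho> b a) \<partial>P0)) = of_nat n * ennreal (- (\<integral>a. ln (\<rho> b a) \<partial>P0))"
    unfolding ennreal_of_nat_eq_real_of_nat by (rule ennreal_mult') simp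
  also have "ennreal 1 + of_nat n * ennreal (- (\<integral>a. ln (\<rho> b a) \<partial>P0)) \<le> 1 + of_nat n * kl b"
    using k(2) by (simp add: mult_left_mono)
  finally show ?thesis by (simp add: add.commute)
qed


text \<open>\<open>LR - ln LR\<close> replaces \<open>- ln LR\<close> since it is nonnegative, so that Tonelli and Markov apply;
  the added term has expectation 1.\<close>

definition "Y D = (\<integral>\<^sup>+b. ennreal (LR b D - ln (LR b D)) \<partial>q) + (\<integral>\<^sup>+b. ennreal (LR b D) \<partial>T)
    + (\<integral>\<^sup>+b. ennreal (exp (real n * \<kappa>) * W D * (indicator A b * LR b D)) \<partial>T)"

sublocale qS: pair_sigma_finite q S ..
sublocale TS: pair_sigma_finite T S ..

lemma Y_meas[measurable]: "Y \<in> borel_measurable S"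
  unfolding Y_def by measurable

text \<open>By Tonelli each summand is first integrated over the data. The evidence contributes 1.
  The last summand contributes at most 1, because its factor exp (n \<kappa>) exactly offsets the
  bound in \<open>W_LR_int\<close>. The third unit comes from adding \<open>LR\<close> to - ln
  \<open>LR\<close>.\<close>

lemma Y_int: "(\<integral>\<^sup>+D. Y D \<partial>S) \<le> of_nat n * (\<integral>\<^sup>+b. kl b \<partial>q) + 3"
proof -
  define E where "E b = (\<integral>\<^sup>+D. ennreal (LR b D - ln (LR b D)) \<partial>S)" for b
  have [measurable]: "E \<in> borel_measurable q" unfolding E_def by measurable
  have n0: "ennreal (1 / real n) * of_nat n = 1"
    using n by (simp add: ennreal_of_nat_eq_real_of_nat ennreal_mult'[symmetric])
  \<comment> \<open>\<open>kl\<close> need not be measurable, so only monotonicity of its (lower) integral is available;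
    hence linearity is applied to \<open>(E - 1) / n \<le> kl\<close> instead.\<close>
  have "(\<integral>\<^sup>+D. \<integral>\<^sup>+b. ennreal (LR b D - ln (LR b D)) \<partial>q \<partial>S) = (\<integral>\<^sup>+b. E b \<partial>q)"
    unfolding E_def by (rule qS.Fubini') measurable
  also have "\<dots> \<le> (\<integral>\<^sup>+b. of_nat n * (ennreal (1 / real n) * (E b - 1)) + 1 \<partial>q)"
  proof (rule nn_integral_mono)
    fix b
    have "of_nat n * (ennreal (1 / real n) * (E b - 1)) = E b - 1"
      using n0 by (metis mult.assoc mult.commute mult_1)
    then show "E b \<le> of_nat n * (ennreal (1 / real n) * (E b - 1)) + 1"
      by (metis add.commute ennreal_minus_le_iff order_refl)
  qed
  also have "\<dots> = of_nat n * (\<integral>\<^sup>+b. ennreal (1 / real n) * (E b - 1) \<partial>q) + 1"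
    by (subst nn_integral_add) (auto simp: nn_integral_cmult q.emeasure_space_1)
  also have "\<dots> \<le> of_nat n * (\<integral>\<^sup>+b. kl b \<partial>q) + 1"
  proof (intro add_right_mono mult_left_mono nn_integral_mono)
    fix b assume "b \<in> space q"
    then have "E b \<le> of_nat n * kl b + 1"
      unfolding E_def by (intro LR_diff_ln_int) (simp add: space_q)
    then have "E b - 1 \<le> of_nat n * kl b"
      by (simp add: ennreal_minus_le_iff add.commute)
    then have "ennreal (1 / real n) * (E b - 1) \<le> ennreal (1 / real n) * (of_nat n * kl b)"
      by (rule mult_left_mono) simp
    also have "\<dots> = kl b" by (simp add: mult.assoc[symmetric] n0)
    finally show "ennreal (1 / real n) * (E b - 1) \<le> kl b" .
  qed simp
  finally have 1: "(\<integral>\<^sup>+D. \<integral>\<^sup>+b. ennreal (LR b D - ln (LR b D)) \<partial>q \<partial>S) \<le> of_nat n * (\<integral>\<^sup>+b. kl b \<partial>q) + 1" .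
  have "(\<integral>\<^sup>+D. \<integral>\<^sup>+b. ennreal (LR b D) \<partial>T \<partial>S) = (\<integral>\<^sup>+b. \<integral>\<^sup>+D. ennreal (LR b D) \<partial>S \<partial>T)"
    by (rule TS.Fubini') measurable
  also have "\<dots> = (\<integral>\<^sup>+b. 1 \<partial>T)"
    by (intro nn_integral_cong LR_int)
  finally have 2: "(\<integral>\<^sup>+D. \<integral>\<^sup>+b. ennreal (LR b D) \<partial>T \<partial>S) = 1"
    by (simp add: T.emeasure_space_1)
  have "(\<integral>\<^sup>+D. \<integral>\<^sup>+b. ennreal (exp (real n * \<kappa>) * W D * (indicator A b * LR b D)) \<partial>T \<partial>S)
      = (\<integral>\<^sup>+b. \<integral>\<^sup>+D. ennreal (exp (real n * \<kappa>) * W D * (indicator A b * LR b D)) \<partial>S \<partial>T)"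
    by (rule TS.Fubini') measurable
  also have "\<dots> \<le> (\<integral>\<^sup>+b. 1 \<partial>T)"
  proof (rule nn_integral_mono)
    fix b assume b: "b \<in> space T"
    note [measurable] = LR_meas1[OF b]
    show "(\<integral>\<^sup>+D. ennreal (exp (real n * \<kappa>) * W D * (indicator A b * LR b D)) \<partial>S) \<le> 1"
    proof (cases "b \<in> A")
      case True
      have "(\<integral>\<^sup>+D. ennreal (exp (real n * \<kappa>) * W D * (indicator A b * LR b D)) \<partial>S)
        = (\<integral>\<^sup>+D. ennreal (exp (real n * \<kappa>)) * ennreal (W D * LR b D) \<partial>S)"
        using True by (simp add: ennreal_mult'[symmetric] mult.assoc)
      also have "\<dots> = ennreal (exp (real n * \<kappa>)) * (\<integral>\<^sup>+D. ennreal (W D * LR b D) \<partial>S)"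
        by (rule nn_integral_cmult) measurable
      also have "\<dots> \<le> ennreal (exp (real n * \<kappa>)) * ennreal (exp (- real n * \<kappa>))"
        by (intro mult_left_mono W_LR_int True) auto
      also have "\<dots> = 1" by (simp add: ennreal_mult'[symmetric] exp_add[symmetric])
      finally show ?thesis .
    qed simp
  qed
  finally have 3: "(\<integral>\<^sup>+D. \<integral>\<^sup>+b. ennreal (exp (real n * \<kappa>) * W D * (indicator A b * LR b D)) \<partial>T \<partial>S) \<le> 1"
    by (simp add: T.emeasure_space_1)
  have "(\<integral>\<^sup>+D. Y D \<partial>S) = (\<integral>\<^sup>+D. \<integral>\<^sup>+b. ennreal (LR b D - ln (LR b D)) \<partial>q \<partial>S)
      + (\<integral>\<^sup>+D. \<integral>\<^sup>+b. ennreal (LR b D) \<partial>T \<partial>S)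
      + (\<integral>\<^sup>+D. \<integral>\<^sup>+b. ennreal (exp (real n * \<kappa>) * W D * (indicator A b * LR b D)) \<partial>T \<partial>S)"
    unfolding Y_def by (simp add: nn_integral_add)
  also have "\<dots> \<le> (of_nat n * (\<integral>\<^sup>+b. kl b \<partial>q) + 1) + 1 + 1"
    using 1 2 3 by (intro add_mono) auto
  finally show ?thesis by (simp add: add.assoc)
qed

definition "posterior D = density T (\<lambda>b. ennreal (LR b D) / (\<integral>\<^sup>+b. ennreal (LR b D) \<partial>T))"

text \<open>This is \<open>variational_event_bound\<close> at t = n \<kappa>, the largest exponent
  that the test can pay for. The terms on the right that depend on the data are, up to ln x \<le> x
  and W \<ge> 1, the three summands of Y. A finite Y also supplies all the integrability.\<close>

lemma event_bound_off_bad_set: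
  assumes D: "D \<in> space S" and Y: "Y D < ennreal \<tau>" and W1: "1 \<le> W D"
    and Q': "prob_space Q'" and opt: "kl_div Q' (posterior D) \<le> kl_div q (posterior D)"
  shows "real n * \<kappa> * measure Q' A \<le> (\<integral>b. ln (dq b) \<partial>q) + \<tau>"
proof -
  note [measurable] = LR_meas2[OF D]
  have pos: "0 < LR b D" if "b \<in> space T" for b using LR_pos[OF that D] .
  have h0: "AE b in q. 0 \<le> LR b D - ln (LR b D)"
  proof (rule AE_I2)
    fix b assume "b \<in> space q"
    then have "0 < LR b D" using pos by (simp add: space_q)
    then show "0 \<le> LR b D - ln (LR b D)" using diff_ln_ge(1)[of "LR b D"] by linarith
  qed
  have LR0: "AE b in T. 0 \<le> LR b D" by (intro AE_I2 less_imp_le pos)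
  have tp: "0 < \<tau>" using Y by (metis ennreal_eq_0_iff not_le not_less_zero)
  have fin1: "(\<integral>\<^sup>+b. ennreal (LR b D - ln (LR b D)) \<partial>q) < \<infinity>"
    and fin2: "(\<integral>\<^sup>+b. ennreal (LR b D) \<partial>T) < \<infinity>"
  proof -
    have "Y D < \<infinity>" using order.strict_trans[OF Y ennreal_less_top] by simp
    then show "(\<integral>\<^sup>+b. ennreal (LR b D - ln (LR b D)) \<partial>q) < \<infinity>"
      "(\<integral>\<^sup>+b. ennreal (LR b D) \<partial>T) < \<infinity>" unfolding Y_def by (auto simp: less_top[symmetric])
  qed
  have hint: "integrable q (\<lambda>b. LR b D - ln (LR b D))"
    by (rule integrableI_nonneg) (use h0 fin1 in auto)
  have gint: "integrable T (\<lambda>b. LR b D)"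
    by (rule integrableI_nonneg) (use LR0 fin2 in auto)
  have lg: "integrable q (\<lambda>b. ln (LR b D))"
  proof (rule Bochner_Integration.integrable_bound)
    show "integrable q (\<lambda>b. 3 * (LR b D - ln (LR b D)))" by (intro integrable_mult_right hint)
    show "AE b in q. norm (ln (LR b D)) \<le> norm (3 * (LR b D - ln (LR b D)))"
    proof (rule AE_I2)
      fix b assume "b \<in> space q"
      then have "0 < LR b D" using pos by (simp add: space_q)
      then show "norm (ln (LR b D)) \<le> norm (3 * (LR b D - ln (LR b D)))"
        using diff_ln_ge(2)[of "LR b D"] by simp
    qed
  qed measurable
  define Z where "Z = (\<integral>b. LR b D \<partial>T)"
  define N where "N = (\<integral>b. indicator A b * LR b D \<partial>T)"
  define H where "H = (\<integral>b. LR b D - ln (LR b D) \<partial>q)"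
  have Zpos: "0 < Z"
    unfolding Z_def
    by (rule kl_div_tilted(2)[OF T.prob_space_axioms dq_meas dq0 q_eq q.prob_space_axioms dq_pos dq_int
        _ _ gint lg]) (use pos in auto)
  have Zeq: "(\<integral>\<^sup>+b. ennreal (LR b D) \<partial>T) = ennreal Z"
    unfolding Z_def by (rule nn_integral_eq_integral[OF gint LR0])
  have post: "posterior D = density T (\<lambda>b. ennreal (LR b D / Z))"
    unfolding posterior_def Zeq
    by (rule density_cong) (use Zpos pos in \<open>auto intro!: AE_I2 simp: divide_ennreal less_imp_le\<close>)
  have bound: "real n * \<kappa> * measure Q' A \<le> (\<integral>b. ln (dq b) \<partial>q) - (\<integral>b. ln (LR b D) \<partial>q)
      + ln (Z + exp (real n * \<kappa>) * N)"
    unfolding N_def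
    by (rule variational_event_bound[OF T.prob_space_axioms dq_meas dq0 q_eq q.prob_space_axioms dq_pos
          dq_int _ _ gint lg Z_def Q' _ A_meas])
      (use pos opt post in \<open>auto simp: \<kappa>_def\<close>)
  have iN: "integrable T (\<lambda>b. indicator A b * LR b D)"
    using integrable_real_mult_indicator[OF A_meas gint] by (simp add: mult.commute)
  have N0: "0 \<le> N" unfolding N_def
    using pos by (intro integral_nonneg_AE AE_I2) (auto simp: indicator_def less_imp_le)
  have "- (\<integral>b. ln (LR b D) \<partial>q) = (\<integral>b. - ln (LR b D) \<partial>q)" by simp
  also have "\<dots> \<le> H"
    unfolding H_def using lg hint pos
    by (intro integral_mono) (auto simp: space_q less_imp_le)
  finally have b1: "- (\<integral>b. ln (LR b D) \<partial>q) \<le> H" .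
  \<comment> \<open>The crude bound ln x \<le> x suffices: once W is inserted, both terms have
    expectation at most 1.\<close>
  have "ln (Z + exp (real n * \<kappa>) * N) \<le> Z + exp (real n * \<kappa>) * N"
    using Zpos N0 by (intro less_imp_le ln_less_self) (auto intro!: add_pos_nonneg)
  also have "exp (real n * \<kappa>) * N \<le> exp (real n * \<kappa>) * W D * N"
    using W1 N0 by (simp add: mult_right_mono)
  finally have b2: "ln (Z + exp (real n * \<kappa>) * N) \<le> Z + exp (real n * \<kappa>) * W D * N" by simp
  have H0: "0 \<le> H" unfolding H_def by (intro integral_nonneg_AE h0)
  have "(\<integral>\<^sup>+b. ennreal (exp (real n * \<kappa>) * W D * (indicator A b * LR b D)) \<partial>T)
      = ennreal (\<integral>b. exp (real n * \<kappa>) * W D * (indicator A b * LR b D) \<partial>T)"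
    using iN pos W1 by (intro nn_integral_eq_integral AE_I2) (auto simp: indicator_def less_imp_le)
  then have "Y D = ennreal H + ennreal Z + ennreal (exp (real n * \<kappa>) * W D * N)"
    unfolding Y_def Zeq N_def H_def using nn_integral_eq_integral[OF hint h0] by simp
  also have "\<dots> = ennreal (H + Z + exp (real n * \<kappa>) * W D * N)"
    using H0 Zpos N0 W1 by (simp add: ennreal_plus[symmetric] del: ennreal_plus)
  finally have YD: "Y D = ennreal (H + Z + exp (real n * \<kappa>) * W D * N)" .
  have "0 \<le> H + Z + exp (real n * \<kappa>) * W D * N" using H0 Zpos N0 W1 by simp
  then have "H + Z + exp (real n * \<kappa>) * W D * N < \<tau>"
    using Y YD ennreal_less_iff by simp
  then show ?thesis using bound b1 b2 by linarith
qed

text \<open>Two applications of Markov's inequality, to 1 / W and to Y. The exceptional set is fixed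
  before D and Q', so Q' may depend on D in an arbitrary, possibly non-measurable way.\<close>

lemma bad_set:
  assumes K: "(\<integral>\<^sup>+b. kl b \<partial>q) \<le> ennreal K" "0 \<le> K" and tau: "0 < \<tau>"
  shows "\<exists>B\<in>sets S. measure S B \<le> exp (- real n * \<kappa>) + (real n * K + 3) / \<tau> \<and>
    (\<forall>D\<in>space S - B. \<forall>Q'. prob_space Q' \<longrightarrow> kl_div Q' (posterior D) \<le> kl_div q (posterior D) \<longrightarrow>
       real n * \<kappa> * measure Q' A \<le> (\<integral>b. ln (dq b) \<partial>q) + \<tau>)"
proof -
  \<comment> \<open>Both sets have the form required by Markov's inequality, whence the factor 1.
    \<open>B1\<close> contains the rejection region W < 1.\<close>
  define B1 where "B1 = {D\<in>space S. 1 \<le> 1 * ennreal (1 / W D)}"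
  define B2 where "B2 = {D\<in>space S. 1 \<le> ennreal (1 / \<tau>) * Y D}"
  have [measurable]: "B1 \<in> sets S" "B2 \<in> sets S" unfolding B1_def B2_def by measurable
  have "emeasure S B1 \<le> 1 * (\<integral>\<^sup>+D. ennreal (1 / W D) * indicator (space S) D \<partial>S)"
    unfolding B1_def by (rule nn_integral_Markov_inequality) auto
  also have "\<dots> = (\<integral>\<^sup>+D. ennreal (1 / W D) \<partial>S)" by (auto intro!: nn_integral_cong)
  also note W_inverse_int
  finally have m1: "measure S B1 \<le> exp (- real n * \<kappa>)"
    unfolding measure_def by (intro enn2real_leI) auto
  have "emeasure S B2 \<le> ennreal (1 / \<tau>) * (\<integral>\<^sup>+D. Y D * indicator (space S) D \<partial>S)"
    unfolding B2_def by (rule nn_integral_Markov_inequality) auto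
  also have "(\<integral>\<^sup>+D. Y D * indicator (space S) D \<partial>S) = (\<integral>\<^sup>+D. Y D \<partial>S)"
    by (auto intro!: nn_integral_cong)
  also have "ennreal (1 / \<tau>) * (\<integral>\<^sup>+D. Y D \<partial>S) \<le> ennreal (1 / \<tau>) * (of_nat n * ennreal K + 3)"
    by (intro mult_left_mono order_trans[OF Y_int] add_mono K) auto
  also have "of_nat n * ennreal K + 3 = ennreal (real n * K + 3)"
    using K(2) by (simp add: ennreal_plus ennreal_mult' ennreal_of_nat_eq_real_of_nat)
  also have "ennreal (1 / \<tau>) * ennreal (real n * K + 3) = ennreal ((real n * K + 3) / \<tau>)"
    using tau by (subst ennreal_mult'[symmetric]) auto
  finally have m2: "measure S B2 \<le> (real n * K + 3) / \<tau>"
    unfolding measure_def using K(2) tau by (intro enn2real_leI) auto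
  have "measure S (B1 \<union> B2) \<le> exp (- real n * \<kappa>) + (real n * K + 3) / \<tau>"
    using measure_Un_le[of B1 S B2] m1 m2 by simp
  moreover have "real n * \<kappa> * measure Q' A \<le> (\<integral>b. ln (dq b) \<partial>q) + \<tau>"
    if D: "D \<in> space S - (B1 \<union> B2)" and Q': "prob_space Q'"
      and opt: "kl_div Q' (posterior D) \<le> kl_div q (posterior D)" for D Q'
  proof (rule event_bound_off_bad_set[OF _ _ _ Q' opt])
    show "D \<in> space S" using D by simp
    have "\<not> 1 \<le> 1 / W D" using D by (auto simp: B1_def)
    then show "1 \<le> W D" using W_pos[of D] by (simp add: field_simps)
    show "Y D < ennreal \<tau>"
    proof (rule ccontr)
      assume "\<not> Y D < ennreal \<tau>"
      then have "ennreal (1 / \<tau>) * ennreal \<tau> \<le> ennreal (1 / \<tau>) * Y D"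
        by (intro mult_left_mono) auto
      moreover have "ennreal (1 / \<tau>) * ennreal \<tau> = 1"
        using tau by (subst ennreal_mult'[symmetric]) auto
      ultimately show False using D by (auto simp: B2_def)
    qed
  qed
  ultimately show ?thesis by (intro bexI[of _ "B1 \<union> B2"]) auto
qed

end

section \<open>The Gaussian regression model\<close>

lemma unit_cube_sets[measurable]: "unit_cube p \<in> sets (input_space p)"
  unfolding unit_cube_def input_space_def by (rule sets_PiM_I_finite) auto

lemma emeasure_unit_cube: "emeasure (input_space p) (unit_cube p) = 1"
proof -
  interpret product_sigma_finite "\<lambda>_::nat. lborel :: real measure" ..
  show ?thesis unfolding unit_cube_def input_space_def
    by (subst emeasure_PiM) auto
qed

lemma sigma_finite_input_space: "sigma_finite_measure (input_space p)"
proof -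
  interpret product_sigma_finite "\<lambda>_::nat. lborel :: real measure" ..
  show ?thesis unfolding input_space_def by (rule sigma_finite) simp
qed

lemma nn_integral_obs_space:
  assumes "f \<in> borel_measurable (obs_space p)"
  shows "(\<integral>\<^sup>+z. f z \<partial>obs_space p) = (\<integral>\<^sup>+x. \<integral>\<^sup>+y. f (y, x) \<partial>lborel \<partial>input_space p)"
proof -
  interpret I: sigma_finite_measure "input_space p" by (rule sigma_finite_input_space)
  interpret pair_sigma_finite lborel "input_space p" ..
  show ?thesis using nn_integral_snd[of f] assms by (simp add: obs_space_def)
qed

lemma sigma_finite_obs_space: "sigma_finite_measure (obs_space p)"
proof -
  interpret I: sigma_finite_measure "input_space p" by (rule sigma_finite_input_space)
  interpret pair_sigma_finite lborel "input_space p" ..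
  show ?thesis unfolding obs_space_def by (rule sigma_finite_measure_axioms)
qed

text \<open>Completing the square at the midpoint; adding two exponents of variance 1 gives variance
  1/2.\<close>

lemma normal_density_mult:
  "normal_density a 1 y * normal_density b 1 y
     = exp (- (a - b)\<^sup>2 / 4) / sqrt (4 * pi) * normal_density ((a + b) / 2) (1 / sqrt 2) y"
proof -
  have e: "- (y - a)\<^sup>2 / 2 + - (y - b)\<^sup>2 / 2 = - (a - b)\<^sup>2 / 4 + - (y - (a + b) / 2)\<^sup>2"
    by (simp add: power2_eq_square field_simps)
  have "normal_density a 1 y * normal_density b 1 y
      = 1 / (2 * pi) * exp (- (y - a)\<^sup>2 / 2 + - (y - b)\<^sup>2 / 2)"
    unfolding exp_add by (simp add: normal_density_def)
  also have "\<dots> = 1 / (2 * pi) * (exp (- (a - b)\<^sup>2 / 4) * exp (- (y - (a + b) / 2)\<^sup>2))"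
    unfolding e exp_add ..
  also have "\<dots> = exp (- (a - b)\<^sup>2 / 4) / sqrt (4 * pi) * normal_density ((a + b) / 2) (1 / sqrt 2) y"
    by (simp add: normal_density_def power_divide real_sqrt_mult)
  finally show ?thesis .
qed

lemma nn_integral_normal_density:
  "0 < \<sigma> \<Longrightarrow> (\<integral>\<^sup>+y. ennreal (normal_density m \<sigma> y) \<partial>lborel) = 1"
  by (subst nn_integral_eq_integral)
    (auto simp: integrable_normal_density integral_normal_density)

text \<open>The kernel is sqrt (2 pi) times the unit normal density at b, so this is a rescaled N(0,
  2) density at a - b. It is largest at a = b, hence a wrong regression value can only lower the
  mean of the kernel.\<close>

lemma nn_integral_normal_kernel:
  "(\<integral>\<^sup>+y. ennreal (normal_density a 1 y * exp (- (y - b)\<^sup>2 / 2)) \<partial>lborel)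
     = ennreal (exp (- (a - b)\<^sup>2 / 4) / sqrt 2)"
proof -
  have "normal_density a 1 y * exp (- (y - b)\<^sup>2 / 2)
      = exp (- (a - b)\<^sup>2 / 4) / sqrt 2 * normal_density ((a + b) / 2) (1 / sqrt 2) y" for y
  proof -
    have "exp (- (y - b)\<^sup>2 / 2) = sqrt (2 * pi) * normal_density b 1 y"
      by (simp add: normal_density_def)
    then have "normal_density a 1 y * exp (- (y - b)\<^sup>2 / 2)
        = sqrt (2 * pi) * (normal_density a 1 y * normal_density b 1 y)" by simp
    also have "\<dots> = exp (- (a - b)\<^sup>2 / 4) * (sqrt (2 * pi) / sqrt (4 * pi))
        * normal_density ((a + b) / 2) (1 / sqrt 2) y"
      unfolding normal_density_mult by (simp only: times_divide_eq_left times_divide_eq_right mult_ac)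
    also have "sqrt (2 * pi) / sqrt (4 * pi) = 1 / sqrt 2"
      using real_sqrt_divide[of "2 * pi" "4 * pi"] by (simp add: real_sqrt_divide)
    finally show ?thesis by simp
  qed
  then have "(\<integral>\<^sup>+y. ennreal (normal_density a 1 y * exp (- (y - b)\<^sup>2 / 2)) \<partial>lborel)
     = (\<integral>\<^sup>+y. ennreal (exp (- (a - b)\<^sup>2 / 4) / sqrt 2)
          * ennreal (normal_density ((a + b) / 2) (1 / sqrt 2) y) \<partial>lborel)"
    by (simp add: ennreal_mult'[symmetric])
  also have "\<dots> = ennreal (exp (- (a - b)\<^sup>2 / 4) / sqrt 2)"
    by (subst nn_integral_cmult) (auto simp: nn_integral_normal_density)
  finally show ?thesis .
qed

text \<open>The Hellinger affinity of two unit-variance normal laws: the root of the product is a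
  multiple of the normal density at the midpoint.\<close>

lemma nn_integral_sqrt_normal_density:
  "(\<integral>\<^sup>+y. ennreal (sqrt (normal_density a 1 y) * sqrt (normal_density b 1 y)) \<partial>lborel)
     = ennreal (exp (- (a - b)\<^sup>2 / 8))"
proof -
  have "sqrt (normal_density a 1 y) * sqrt (normal_density b 1 y)
      = exp (- (a - b)\<^sup>2 / 8) * normal_density ((a + b) / 2) 1 y" for y
  proof -
    have e: "- (y - a)\<^sup>2 / 2 + - (y - b)\<^sup>2 / 2 = 2 * (- (a - b)\<^sup>2 / 8 + - (y - (a + b) / 2)\<^sup>2 / 2)"
      by (simp add: power2_eq_square field_simps)
    have "normal_density a 1 y * normal_density b 1 y
        = (1 / sqrt (2 * pi))\<^sup>2 * exp (- (y - a)\<^sup>2 / 2 + - (y - b)\<^sup>2 / 2)"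
      unfolding exp_add by (simp add: normal_density_def power2_eq_square)
    also have "\<dots> = (1 / sqrt (2 * pi))\<^sup>2 * (exp (- (a - b)\<^sup>2 / 8 + - (y - (a + b) / 2)\<^sup>2 / 2))\<^sup>2"
      unfolding e exp_double ..
    also have "\<dots> = (exp (- (a - b)\<^sup>2 / 8) * normal_density ((a + b) / 2) 1 y)\<^sup>2"
      unfolding exp_add by (simp add: normal_density_def power_mult_distrib power_divide)
    finally show ?thesis
      by (subst real_sqrt_mult[symmetric]) (simp add: real_sqrt_unique)
  qed
  then have "(\<integral>\<^sup>+y. ennreal (sqrt (normal_density a 1 y) * sqrt (normal_density b 1 y)) \<partial>lborel)
     = (\<integral>\<^sup>+y. ennreal (exp (- (a - b)\<^sup>2 / 8)) * ennreal (normal_density ((a + b) / 2) 1 y) \<partial>lborel)"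
    by (simp add: ennreal_mult')
  also have "\<dots> = ennreal (exp (- (a - b)\<^sup>2 / 8))"
    by (subst nn_integral_cmult) (auto simp: nn_integral_normal_density)
  finally show ?thesis .
qed

section \<open>Regression densities, their Hellinger affinity and the test statistic\<close>

lemma reg_density_eq:
  "reg_density p \<eta> (y, x) = indicator (unit_cube p) x * normal_density (\<eta> x) 1 y"
  by (simp add: reg_density_def)

lemma reg_density_nonneg: "0 \<le> reg_density p \<eta> z"
  by (cases z) (simp add: reg_density_eq indicator_def)

lemma normal_density_measurable2[measurable (raw)]:
  assumes [measurable]: "f \<in> borel_measurable M" "g \<in> borel_measurable M"
  shows "(\<lambda>x. normal_density (f x) 1 (g x)) \<in> borel_measurable M"
  unfolding normal_density_def by measurable

lemma reg_density_measurable[measurable]: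
  assumes [measurable]: "\<eta> \<in> borel_measurable (input_space p)"
  shows "reg_density p \<eta> \<in> borel_measurable (obs_space p)"
  unfolding reg_density_def obs_space_def split_beta by measurable

lemma nn_integral_reg_density_mult:
  assumes eta[measurable]: "\<eta> \<in> borel_measurable (input_space p)" and f[measurable]: "f \<in> borel_measurable (obs_space p)"
    and inner: "\<And>x. x \<in> unit_cube p \<Longrightarrow>
       (\<integral>\<^sup>+y. ennreal (normal_density (\<eta> x) 1 y * f (y, x)) \<partial>lborel) = ennreal (c x)"
  shows "(\<integral>\<^sup>+z. ennreal (reg_density p \<eta> z * f z) \<partial>obs_space p)
     = (\<integral>\<^sup>+x. indicator (unit_cube p) x * ennreal (c x) \<partial>input_space p)"
proof -
  have "(\<integral>\<^sup>+z. ennreal (reg_density p \<eta> z * f z) \<partial>obs_space p)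
      = (\<integral>\<^sup>+x. \<integral>\<^sup>+y. ennreal (reg_density p \<eta> (y, x) * f (y, x)) \<partial>lborel \<partial>input_space p)"
    by (rule nn_integral_obs_space) measurable
  also have "\<dots> = (\<integral>\<^sup>+x. indicator (unit_cube p) x * ennreal (c x) \<partial>input_space p)"
    by (rule nn_integral_cong) (auto simp: reg_density_eq indicator_def inner)
  finally show ?thesis .
qed

lemma nn_integral_reg_density:
  assumes [measurable]: "\<eta> \<in> borel_measurable (input_space p)"
  shows "(\<integral>\<^sup>+z. ennreal (reg_density p \<eta> z) \<partial>obs_space p) = 1"
  using nn_integral_reg_density_mult[of \<eta> p "\<lambda>_. 1" "\<lambda>_. 1"]
  by (simp add: nn_integral_normal_density emeasure_unit_cube)

lemma prob_space_reg_model: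
  assumes [measurable]: "\<eta> \<in> borel_measurable (input_space p)"
  shows "prob_space (reg_model p \<eta>)"
proof
  show "emeasure (reg_model p \<eta>) (space (reg_model p \<eta>)) = 1"
    unfolding reg_model_def
    by (simp add: emeasure_density nn_integral_reg_density cong: nn_integral_cong)
qed

lemma sets_reg_model[measurable_cong]: "sets (reg_model p \<eta>) = sets (obs_space p)"
  by (simp add: reg_model_def)

lemma space_reg_model: "space (reg_model p \<eta>) = space (obs_space p)"
  by (simp add: reg_model_def)

text \<open>The squared Hellinger distance is 1 minus the affinity, and the affinity is the integral
  of the conditional affinities given x.\<close>

lemma hellinger_affinity:
  assumes e0[measurable]: "\<eta>0 \<in> borel_measurable (input_space p)"
    and e1[measurable]: "\<eta> \<in> borel_measurable (input_space p)"
    and c: "0 \<le> c" "c \<le> 1" and h: "c < hellinger (obs_space p) (reg_density p \<eta>0) (reg_density p \<eta>)"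
  shows "(\<integral>\<^sup>+x. indicator (unit_cube p) x * ennreal (exp (- (\<eta>0 x - \<eta> x)\<^sup>2 / 8)) \<partial>input_space p)
    \<le> ennreal (1 - c\<^sup>2)"
proof -
  let ?f = "reg_density p \<eta>0" and ?g = "reg_density p \<eta>"
  define I where "I = (\<integral>\<^sup>+z. ennreal ((sqrt (?f z) - sqrt (?g z))\<^sup>2) \<partial>obs_space p)"
  define J where "J = (\<integral>\<^sup>+z. ennreal (sqrt (?f z) * sqrt (?g z)) \<partial>obs_space p)"
  have "J = (\<integral>\<^sup>+x. \<integral>\<^sup>+y. ennreal (sqrt (?f (y, x)) * sqrt (?g (y, x))) \<partial>lborel \<partial>input_space p)"
    unfolding J_def by (rule nn_integral_obs_space) measurable
  also have "\<dots> = (\<integral>\<^sup>+x. indicator (unit_cube p) x * ennreal (exp (- (\<eta>0 x - \<eta> x)\<^sup>2 / 8)) \<partial>input_space p)"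
    by (rule nn_integral_cong) (auto simp: reg_density_eq indicator_def nn_integral_sqrt_normal_density)
  finally have J: "J = (\<integral>\<^sup>+x. indicator (unit_cube p) x * ennreal (exp (- (\<eta>0 x - \<eta> x)\<^sup>2 / 8)) \<partial>input_space p)" .
  \<comment> \<open>The identity is kept additive, which avoids subtraction of extended reals. The
    total 2 then shows that both integrals are finite.\<close>
  have "I + 2 * J = (\<integral>\<^sup>+z. ennreal ((sqrt (?f z) - sqrt (?g z))\<^sup>2) + 2 * ennreal (sqrt (?f z) * sqrt (?g z)) \<partial>obs_space p)"
    unfolding I_def J_def by (subst nn_integral_add) (auto simp: nn_integral_cmult)
  also have "\<dots> = (\<integral>\<^sup>+z. ennreal (?f z) + ennreal (?g z) \<partial>obs_space p)"
  proof (rule nn_integral_cong)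
    fix z
    have nn: "0 \<le> ?f z" "0 \<le> ?g z" by (auto simp: reg_density_nonneg)
    have "ennreal ((sqrt (?f z) - sqrt (?g z))\<^sup>2) + 2 * ennreal (sqrt (?f z) * sqrt (?g z))
        = ennreal ((sqrt (?f z) - sqrt (?g z))\<^sup>2 + 2 * (sqrt (?f z) * sqrt (?g z)))"
      using nn by (simp add: ennreal_plus ennreal_mult')
    also have "(sqrt (?f z) - sqrt (?g z))\<^sup>2 + 2 * (sqrt (?f z) * sqrt (?g z)) = ?f z + ?g z"
      using nn by (simp add: power2_diff)
    finally show "ennreal ((sqrt (?f z) - sqrt (?g z))\<^sup>2) + 2 * ennreal (sqrt (?f z) * sqrt (?g z))
        = ennreal (?f z) + ennreal (?g z)" using nn by (simp add: ennreal_plus)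
  qed
  also have "\<dots> = 2"
    by (subst nn_integral_add) (auto simp: nn_integral_reg_density)
  finally have sum: "I + 2 * J = 2" .
  obtain i j where ij: "I = ennreal i" "J = ennreal j" "0 \<le> i" "0 \<le> j"
  proof -
    have "I \<noteq> \<top>" "J \<noteq> \<top>" using sum by (auto simp: ennreal_mult_eq_top_iff)
    then show ?thesis using that by (metis ennreal_cases)
  qed
  have s: "i + 2 * j = 2"
  proof -
    have "ennreal (i + 2 * j) = ennreal 2"
      using sum ij by (simp add: ennreal_plus ennreal_mult')
    then show ?thesis using ij by (subst (asm) ennreal_inj) auto
  qed
  have "I / 2 = ennreal (i / 2)" using ij by (simp add: divide_ennreal[symmetric])
  then have "c < sqrt (i / 2)"
    using h ij by (simp add: hellinger_def I_def)
  then have "c\<^sup>2 < i / 2"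
    using power_strict_mono[of c "sqrt (i / 2)" 2] c(1) ij(3) by simp
  then have "j \<le> 1 - c\<^sup>2" using s by simp
  then have "J \<le> ennreal (1 - c\<^sup>2)" unfolding ij by (rule ennreal_leI)
  then show ?thesis unfolding J .
qed

text \<open>The cube indicator is left out on purpose: this version of the likelihood ratio is
  positive everywhere, whereas the quotient of the two regression densities is 0 / 0 off the
  cube.\<close>

definition "ratio \<eta>0 \<eta> z = normal_density (\<eta> (snd z)) 1 (fst z) / normal_density (\<eta>0 (snd z)) 1 (fst z)"
  for \<eta>0 \<eta> :: "inp \<Rightarrow> real"

text \<open>A function of the residual with values in [0, 1]: its exponential moments are controlled
  however far the fitted regression function is from \<eta>0.\<close>

definition "residual_kernel \<eta>0 z = exp (- (fst z - \<eta>0 (snd z))\<^sup>2 / 2)" for \<eta>0 :: "inp \<Rightarrow> real"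

lemma ratio_pos: "0 < ratio \<eta>0 \<eta> z"
  by (simp add: ratio_def normal_density_pos)

lemma residual_kernel_measurable[measurable]:
  assumes [measurable]: "\<eta>0 \<in> borel_measurable (input_space p)"
  shows "residual_kernel \<eta>0 \<in> borel_measurable (obs_space p)"
  unfolding residual_kernel_def obs_space_def by measurable

lemma ratio_measurable[measurable]:
  assumes [measurable]: "\<eta>0 \<in> borel_measurable (input_space p)" "\<eta> \<in> borel_measurable (input_space p)"
  shows "ratio \<eta>0 \<eta> \<in> borel_measurable (obs_space p)"
  unfolding ratio_def obs_space_def by measurable

lemma residual_kernel_bounds: "0 \<le> residual_kernel \<eta>0 z \<and> residual_kernel \<eta>0 z \<le> 1"
  by (simp add: residual_kernel_def)

lemma reg_density_ratio: "reg_density p \<eta>0 z * ratio \<eta>0 \<eta> z = reg_density p \<eta> z"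
  using normal_density_pos[of 1 "\<eta>0 (snd z)" "fst z"]
  by (cases z) (simp add: reg_density_eq ratio_def)

lemma nn_integral_reg_model:
  assumes [measurable]: "\<eta>0 \<in> borel_measurable (input_space p)" "f \<in> borel_measurable (obs_space p)"
  shows "(\<integral>\<^sup>+z. ennreal (f z) \<partial>reg_model p \<eta>0) = (\<integral>\<^sup>+z. ennreal (reg_density p \<eta>0 z * f z) \<partial>obs_space p)"
  unfolding reg_model_def
  by (subst nn_integral_density) (auto simp: ennreal_mult' reg_density_nonneg)

lemma nn_integral_ratio:
  assumes [measurable]: "\<eta>0 \<in> borel_measurable (input_space p)" "\<eta> \<in> borel_measurable (input_space p)"
  shows "(\<integral>\<^sup>+z. ennreal (ratio \<eta>0 \<eta> z) \<partial>reg_model p \<eta>0) = 1"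
  by (simp add: nn_integral_reg_model reg_density_ratio nn_integral_reg_density)

lemma nn_integral_kernel:
  assumes [measurable]: "\<eta>0 \<in> borel_measurable (input_space p)"
  shows "(\<integral>\<^sup>+z. ennreal (residual_kernel \<eta>0 z) \<partial>reg_model p \<eta>0) = ennreal (1 / sqrt 2)"
proof -
  have "(\<integral>\<^sup>+z. ennreal (residual_kernel \<eta>0 z) \<partial>reg_model p \<eta>0)
    = (\<integral>\<^sup>+x. indicator (unit_cube p) x * ennreal (1 / sqrt 2) \<partial>input_space p)"
    unfolding nn_integral_reg_model[OF assms residual_kernel_measurable[OF assms]]
  proof (rule nn_integral_reg_density_mult)
    show "(\<integral>\<^sup>+y. ennreal (normal_density (\<eta>0 x) 1 y * residual_kernel \<eta>0 (y, x)) \<partial>lborel) = ennreal (1 / sqrt 2)"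
      for x
      using nn_integral_normal_kernel[of "\<eta>0 x" "\<eta>0 x"] by (simp add: residual_kernel_def)
  qed measurable
  then show ?thesis by (simp add: nn_integral_multc emeasure_unit_cube)
qed

text \<open>With t the squared deviation at x, the conditional mean of the kernel under \<eta> is
  exp (-t/4) / sqrt 2. Since exp (-t/4) \<le> exp (-t/8), it is dominated by the conditional
  Hellinger affinity divided by sqrt 2.\<close>

lemma nn_integral_ratio_kernel_le:
  assumes [measurable]: "\<eta>0 \<in> borel_measurable (input_space p)" "\<eta> \<in> borel_measurable (input_space p)"
    and c: "0 \<le> c" "c \<le> 1" and h: "c < hellinger (obs_space p) (reg_density p \<eta>0) (reg_density p \<eta>)"
  shows "(\<integral>\<^sup>+z. ennreal (ratio \<eta>0 \<eta> z * residual_kernel \<eta>0 z) \<partial>reg_model p \<eta>0) \<le> ennreal ((1 - c\<^sup>2) / sqrt 2)"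
proof -
  have "(\<integral>\<^sup>+z. ennreal (ratio \<eta>0 \<eta> z * residual_kernel \<eta>0 z) \<partial>reg_model p \<eta>0)
    = (\<integral>\<^sup>+z. ennreal (reg_density p \<eta> z * residual_kernel \<eta>0 z) \<partial>obs_space p)"
    by (subst nn_integral_reg_model) (auto simp: reg_density_ratio mult.assoc[symmetric])
  also have "\<dots> = (\<integral>\<^sup>+x. indicator (unit_cube p) x * ennreal (exp (- (\<eta> x - \<eta>0 x)\<^sup>2 / 4) / sqrt 2) \<partial>input_space p)"
  proof (rule nn_integral_reg_density_mult)
    show "(\<integral>\<^sup>+y. ennreal (normal_density (\<eta> x) 1 y * residual_kernel \<eta>0 (y, x)) \<partial>lborel)
        = ennreal (exp (- (\<eta> x - \<eta>0 x)\<^sup>2 / 4) / sqrt 2)" for x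
      using nn_integral_normal_kernel[of "\<eta> x" "\<eta>0 x"] by (simp add: residual_kernel_def)
  qed measurable
  also have "\<dots> \<le> (\<integral>\<^sup>+x. ennreal (1 / sqrt 2) *
      (indicator (unit_cube p) x * ennreal (exp (- (\<eta>0 x - \<eta> x)\<^sup>2 / 8))) \<partial>input_space p)"
  proof (rule nn_integral_mono)
    fix x
    have "exp (- (\<eta> x - \<eta>0 x)\<^sup>2 / 4) / sqrt 2 \<le> 1 / sqrt 2 * exp (- (\<eta>0 x - \<eta> x)\<^sup>2 / 8)"
      by (simp add: divide_right_mono power2_commute)
    then have "ennreal (exp (- (\<eta> x - \<eta>0 x)\<^sup>2 / 4) / sqrt 2)
        \<le> ennreal (1 / sqrt 2) * ennreal (exp (- (\<eta>0 x - \<eta> x)\<^sup>2 / 8))"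
      by (subst ennreal_mult'[symmetric]) (auto intro: ennreal_leI)
    then show "indicator (unit_cube p) x * ennreal (exp (- (\<eta> x - \<eta>0 x)\<^sup>2 / 4) / sqrt 2)
      \<le> ennreal (1 / sqrt 2) * (indicator (unit_cube p) x * ennreal (exp (- (\<eta>0 x - \<eta> x)\<^sup>2 / 8)))"
      by (simp add: indicator_def)
  qed
  also have "\<dots> = ennreal (1 / sqrt 2) * (\<integral>\<^sup>+x. indicator (unit_cube p) x * ennreal (exp (- (\<eta>0 x - \<eta> x)\<^sup>2 / 8)) \<partial>input_space p)"
    by (rule nn_integral_cmult) measurable
  also have "\<dots> \<le> ennreal (1 / sqrt 2) * ennreal (1 - c\<^sup>2)"
    by (intro mult_left_mono hellinger_affinity c h) auto
  also have "\<dots> = ennreal ((1 - c\<^sup>2) / sqrt 2)"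
    by (subst ennreal_mult'[symmetric]) auto
  finally show ?thesis .
qed

text \<open>The inverse ratio is a density of the truth against the model, because both regression
  densities live on the same cube. This provides the two \<open>kl\<close> conditions of
  \<open>separated_model\<close>.\<close>

lemma kl_div_reg_model:
  assumes [measurable]: "\<eta>0 \<in> borel_measurable (input_space p)" "\<eta> \<in> borel_measurable (input_space p)"
    and fin: "kl_div (reg_model p \<eta>0) (reg_model p \<eta>) < \<infinity>"
  shows "integrable (reg_model p \<eta>0) (\<lambda>z. ln (ratio \<eta>0 \<eta> z))"
    and "ennreal (- (\<integral>z. ln (ratio \<eta>0 \<eta> z) \<partial>reg_model p \<eta>0)) \<le> kl_div (reg_model p \<eta>0) (reg_model p \<eta>)"
proof -
  have eq: "reg_model p \<eta>0 = density (reg_model p \<eta>) (\<lambda>z. ennreal (ratio \<eta> \<eta>0 z))"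
  proof -
    have "density (reg_model p \<eta>) (\<lambda>z. ennreal (ratio \<eta> \<eta>0 z))
      = density (obs_space p) (\<lambda>z. ennreal (reg_density p \<eta> z) * ennreal (ratio \<eta> \<eta>0 z))"
      unfolding reg_model_def by (rule density_density_eq) auto
    also have "\<dots> = reg_model p \<eta>0"
      unfolding reg_model_def
      by (rule density_cong) (auto simp: ennreal_mult'[symmetric] reg_density_nonneg reg_density_ratio)
    finally show ?thesis ..
  qed
  have ln: "ln (ratio \<eta> \<eta>0 z) = - ln (ratio \<eta>0 \<eta> z)" for z
    by (simp add: ratio_def ln_div normal_density_pos)
  have k: "kl_div (reg_model p \<eta>0) (reg_model p \<eta>) = (if integrable (reg_model p \<eta>0) (\<lambda>z. ln (ratio \<eta> \<eta>0 z))
     then ennreal (\<integral>z. ln (ratio \<eta> \<eta>0 z) \<partial>reg_model p \<eta>0) else \<infinity>)"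
    by (rule kl_div_density[OF prob_space_reg_model _ _ eq]) (auto intro: less_imp_le[OF ratio_pos])
  then show "integrable (reg_model p \<eta>0) (\<lambda>z. ln (ratio \<eta>0 \<eta> z))"
    using fin by (auto simp: ln split: if_splits)
  show "ennreal (- (\<integral>z. ln (ratio \<eta>0 \<eta> z) \<partial>reg_model p \<eta>0)) \<le> kl_div (reg_model p \<eta>0) (reg_model p \<eta>)"
    using k by (auto simp: ln)
qed

section \<open>Networks and spike-and-slab laws\<close>

lemma lipschitz_borel_measurable:
  fixes psi :: "real \<Rightarrow> real"
  assumes "\<forall>a b. \<bar>psi a - psi b\<bar> \<le> \<bar>a - b\<bar>"
  shows "psi \<in> borel_measurable borel"
proof -
  have "1-lipschitz_on UNIV psi"
    using assms by (intro lipschitz_onI) (auto simp: dist_real_def)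
  then show ?thesis
    by (intro borel_measurable_continuous_onI lipschitz_on_continuous_on)
qed

lemma param_component_measurable:
  "\<iota> \<in> param_set L k \<Longrightarrow> (\<lambda>x. fst x \<iota>) \<in> borel_measurable (param_space L k \<Otimes>\<^sub>M M)"
  unfolding param_space_def
  using measurable_compose[OF measurable_fst measurable_component_singleton[of \<iota> "param_set L k" "\<lambda>_. lborel"]]
  by simp

lemma affine_measurable:
  assumes "l \<le> L" "j < k (Suc l)"
    and h: "\<And>i. i < k l \<Longrightarrow> (\<lambda>x. h x i) \<in> borel_measurable (param_space L k \<Otimes>\<^sub>M M)"
  shows "(\<lambda>x. affine k (fst x) l (h x) j) \<in> borel_measurable (param_space L k \<Otimes>\<^sub>M M)"
  unfolding affine_def
  using assms(1,2)
  by (intro borel_measurable_add borel_measurable_sum borel_measurable_times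
      param_component_measurable h) (auto simp: param_set_def)

text \<open>Measurability is joint in parameters and inputs, as Tonelli and the set of Hellinger-far
  parameters require. It is restricted to j < \<open>k l\<close>, since other indices do not refer
  to coordinates of the product spaces.\<close>

lemma hidden_measurable:
  assumes psi: "psi \<in> borel_measurable borel" and k0: "k 0 = p"
  shows "l \<le> Suc L \<Longrightarrow> j < k l \<Longrightarrow>
    (\<lambda>x. hidden psi k (fst x) (snd x) l j) \<in> borel_measurable (param_space L k \<Otimes>\<^sub>M input_space p)"
proof (induction l arbitrary: j)
  case 0
  then have "j < p" using k0 by simp
  then have "(\<lambda>x. x j) \<in> borel_measurable (input_space p)"
    unfolding input_space_def using measurable_component_singleton[of j "{..<p}" "\<lambda>_. lborel"] by simp
  from measurable_compose[OF measurable_snd this] show ?case by simp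
next
  case (Suc l)
  then show ?case
    by (auto intro!: measurable_compose[OF _ psi] affine_measurable)
qed

lemma dnn_measurable:
  assumes psi: "psi \<in> borel_measurable borel" and k: "k 0 = p" "k (Suc L) = 1"
  shows "(\<lambda>x. dnn psi L k (fst x) (snd x)) \<in> borel_measurable (param_space L k \<Otimes>\<^sub>M input_space p)"
  unfolding dnn_def using k by (intro affine_measurable hidden_measurable psi) auto

lemma dnn_measurable_input:
  assumes psi: "psi \<in> borel_measurable borel" and k: "k 0 = p" "k (Suc L) = 1"
    and \<theta>: "\<theta> \<in> space (param_space L k)"
  shows "dnn psi L k \<theta> \<in> borel_measurable (input_space p)"
  using measurable_compose[OF measurable_Pair1'[OF \<theta>] dnn_measurable[OF psi k]] by simp

section \<open>Mixtures over node indicators and mean-field laws\<close>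

lemma finite_node_set: "finite (node_set L k)"
proof -
  have "node_set L k = (SIGMA l:{..L}. {..<k (Suc l)})" by (auto simp: node_set_def)
  then show ?thesis by simp
qed

lemma sum_bern_weight: "(\<Sum>z\<in>indicator_set L k. bern_weight L k \<gamma> z) = 1"
proof -
  have "(\<Prod>lj\<in>node_set L k. \<Sum>b\<in>UNIV. if b then \<gamma> lj else 1 - \<gamma> lj)
      = (\<Sum>z\<in>indicator_set L k. bern_weight L k \<gamma> z)"
    unfolding indicator_set_def bern_weight_def
    by (rule prod_sum_PiE) (auto simp: finite_node_set)
  then show ?thesis by (simp add: UNIV_bool)
qed

lemma sets_mixture[simp]: "sets (mixture L k v K) = sets (joint_space L k)"
  unfolding mixture_def by simp

lemma space_mixture[simp]: "space (mixture L k v K) = space (joint_space L k)"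
  unfolding mixture_def by (simp add: space_measure_of_conv)

text \<open>A measure built by \<open>measure_of\<close> takes the prescribed values only once
  countable additivity is verified. Here it holds section by section, and the sum over indicators
  commutes with the series.\<close>

lemma emeasure_mixture:
  assumes K: "\<And>z. z \<in> indicator_set L k \<Longrightarrow> sets (K z) = sets (param_space L k)"
    and A: "A \<in> sets (joint_space L k)"
  shows "emeasure (mixture L k v K) A = (\<Sum>z\<in>indicator_set L k. ennreal (v z) *
            emeasure (K z) {\<theta> \<in> space (param_space L k). (z, \<theta>) \<in> A})"
  unfolding mixture_def
proof (rule emeasure_measure_of_sigma)
  let ?sec = "\<lambda>A z. {\<theta> \<in> space (param_space L k). (z, \<theta>) \<in> A}"
  let ?m = "\<lambda>A. \<Sum>z\<in>indicator_set L k. ennreal (v z) * emeasure (K z) (?sec A z)"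
  have sec: "?sec A z \<in> sets (K z)" if "A \<in> sets (joint_space L k)" "z \<in> indicator_set L k" for A z
  proof -
    have "A \<subseteq> space (joint_space L k)" using that by (auto dest: sets.sets_into_space)
    then have "?sec A z = Pair z -` A"
      by (auto simp: joint_space_def space_pair_measure)
    moreover have "Pair z -` A \<in> sets (param_space L k)"
      using that unfolding joint_space_def by (intro sets_Pair1)
    ultimately show ?thesis using K that by simp
  qed
  show "sigma_algebra (space (joint_space L k)) (sets (joint_space L k))"
    by (rule sets.sigma_algebra_axioms)
  show "positive (sets (joint_space L k)) ?m" by (simp add: positive_def)
  show "A \<in> sets (joint_space L k)" by fact
  show "countably_additive (sets (joint_space L k)) ?m"
  proof (rule countably_additiveI)
    fix F :: "nat \<Rightarrow> _"
    assume F: "range F \<subseteq> sets (joint_space L k)" "disjoint_family F"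
    have "(\<Sum>i. ?m (F i)) = (\<Sum>z\<in>indicator_set L k. \<Sum>i. ennreal (v z) * emeasure (K z) (?sec (F i) z))"
      by (rule suminf_sum) auto
    also have "\<dots> = ?m (\<Union>i. F i)"
    proof (rule sum.cong[OF refl])
      fix z assume z: "z \<in> indicator_set L k"
      have "(\<Sum>i. emeasure (K z) (?sec (F i) z)) = emeasure (K z) (\<Union>i. ?sec (F i) z)"
        using F z sec by (intro suminf_emeasure) (auto simp: disjoint_family_on_def)
      also have "(\<Union>i. ?sec (F i) z) = ?sec (\<Union>i. F i) z" by auto
      finally show "(\<Sum>i. ennreal (v z) * emeasure (K z) (?sec (F i) z))
          = ennreal (v z) * emeasure (K z) (?sec (\<Union>i. F i) z)" by simp
    qed
    finally show "(\<Sum>i. ?m (F i)) = ?m (\<Union>i. F i)" .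
  qed
qed

lemma prob_space_mixture:
  assumes K: "\<And>z. z \<in> indicator_set L k \<Longrightarrow> prob_space (K z)"
    "\<And>z. z \<in> indicator_set L k \<Longrightarrow> sets (K z) = sets (param_space L k)"
    and v: "\<And>z. z \<in> indicator_set L k \<Longrightarrow> 0 \<le> v z" "(\<Sum>z\<in>indicator_set L k. v z) = 1"
  shows "prob_space (mixture L k v K)"
proof
  have "emeasure (mixture L k v K) (space (mixture L k v K))
      = (\<Sum>z\<in>indicator_set L k. ennreal (v z) *
            emeasure (K z) {\<theta> \<in> space (param_space L k). (z, \<theta>) \<in> space (joint_space L k)})"
    unfolding space_mixture by (rule emeasure_mixture[OF K(2)]) auto
  also have "\<dots> = (\<Sum>z\<in>indicator_set L k. ennreal (v z))"
  proof (rule sum.cong[OF refl])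
    fix z assume z: "z \<in> indicator_set L k"
    interpret prob_space "K z" using K(1) z by simp
    have "{\<theta> \<in> space (param_space L k). (z, \<theta>) \<in> space (joint_space L k)} = space (K z)"
      using z sets_eq_imp_space_eq[OF K(2)[OF z]] by (auto simp: joint_space_def space_pair_measure)
    then show "ennreal (v z) * emeasure (K z) {\<theta> \<in> space (param_space L k). (z, \<theta>) \<in> space (joint_space L k)}
        = ennreal (v z)" by (simp add: emeasure_space_1)
  qed
  also have "\<dots> = 1" using v by (simp add: sum_ennreal)
  finally show "emeasure (mixture L k v K) (space (mixture L k v K)) = 1" .
qed

lemma spike_slab_prob:
  assumes "\<And>\<iota>. 0 < \<sigma> \<iota>"
  shows "prob_space (spike_slab L k \<mu> \<sigma> z)" and "sets (spike_slab L k \<mu> \<sigma> z) = sets (param_space L k)"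
proof -
  show "prob_space (spike_slab L k \<mu> \<sigma> z)"
    unfolding spike_slab_def
    using assms by (intro prob_space_PiM) (auto intro!: prob_space_normal_density prob_space_return split: prod.splits)
  show "sets (spike_slab L k \<mu> \<sigma> z) = sets (param_space L k)"
    unfolding spike_slab_def param_space_def
    by (intro sets_PiM_cong) (auto split: prod.splits)
qed

lemma bern_weight_nonneg:
  assumes "\<And>l j. l \<le> L \<Longrightarrow> 0 \<le> \<gamma> (l, j) \<and> \<gamma> (l, j) \<le> 1"
  shows "0 \<le> bern_weight L k \<gamma> z"
  unfolding bern_weight_def using assms by (intro prod_nonneg) (auto simp: node_set_def)

lemma prob_space_nn_prior:
  assumes "\<forall>l\<le>L. 0 \<le> lam l \<and> lam l \<le> 1"
  shows "prob_space (nn_prior L k lam)"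
  unfolding nn_prior_def using assms
  by (intro prob_space_mixture spike_slab_prob sum_bern_weight bern_weight_nonneg) auto

lemma mean_fieldD:
  assumes "q \<in> mean_field L k"
  shows "prob_space q" and "sets q = sets (joint_space L k)"
proof -
  obtain \<gamma> \<mu> \<sigma> where q: "q = mixture L k (bern_weight L k \<gamma>) (spike_slab L k \<mu> \<sigma>)"
    and g: "\<forall>l j. 0 \<le> \<gamma> (l, j) \<and> \<gamma> (l, j) \<le> 1" and s: "\<forall>\<iota>. 0 < \<sigma> \<iota>"
    using assms unfolding mean_field_def by blast
  show "prob_space q" unfolding q using g s
    by (intro prob_space_mixture spike_slab_prob sum_bern_weight bern_weight_nonneg) auto
  show "sets q = sets (joint_space L k)" unfolding q by simp
qed

lemma sets_nn_prior: "sets (nn_prior L k lam) = sets (joint_space L k)"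
  by (simp add: nn_prior_def)

lemma outer_prob_le:
  assumes "A \<in> sets M" "S \<inter> space M \<subseteq> A"
  shows "outer_prob M S \<le> measure M A"
  unfolding outer_prob_def
  by (rule cInf_lower) (use assms in \<open>auto intro!: bdd_belowI[of _ 0]\<close>)

lemma outer_prob_mono:
  assumes "S \<subseteq> S'"
  shows "outer_prob M S \<le> outer_prob M S'"
  unfolding outer_prob_def
proof (rule cInf_superset_mono)
  have "measure M (space M) \<in> {measure M A |A. A \<in> sets M \<and> S' \<inter> space M \<subseteq> A}" by blast
  then show "{measure M A |A. A \<in> sets M \<and> S' \<inter> space M \<subseteq> A} \<noteq> {}" by blast
qed (use assms in \<open>auto intro!: bdd_belowI[of _ 0]\<close>)

lemma outer_prob_nonneg: "0 \<le> outer_prob M S"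
  unfolding outer_prob_def by (rule cInf_greatest) auto

section \<open>The posterior in terms of likelihood ratios\<close>

lemma likelihood_eq:
  "likelihood psi p L k n \<theta> D
     = (\<Prod>i<n. reg_density p \<eta>0 (D i)) * (\<Prod>i<n. ratio \<eta>0 (dnn psi L k \<theta>) (D i))"
  unfolding likelihood_def prod.distrib[symmetric] reg_density_ratio ..


text \<open>The factor of the likelihood that is free of the parameter cancels against the
  normalisation. It is positive exactly when all inputs lie in the cube.\<close>

lemma nn_posterior_eq:
  assumes pos: "0 < (\<Prod>i<n. reg_density p \<eta>0 (D i))"
    and meas: "(\<lambda>w. \<Prod>i<n. ratio \<eta>0 (dnn psi L k (snd w)) (D i)) \<in> borel_measurable (nn_prior L k lam)"
  shows "nn_posterior psi p L k lam n D = density (nn_prior L k lam)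
    (\<lambda>w. ennreal (\<Prod>i<n. ratio \<eta>0 (dnn psi L k (snd w)) (D i))
      / (\<integral>\<^sup>+w. ennreal (\<Prod>i<n. ratio \<eta>0 (dnn psi L k (snd w)) (D i)) \<partial>nn_prior L k lam))"
proof -
  define c where "c = (\<Prod>i<n. reg_density p \<eta>0 (D i))"
  have c: "0 < c" using pos by (simp add: c_def)
  let ?g = "\<lambda>w. \<Prod>i<n. ratio \<eta>0 (dnn psi L k (snd w)) (D i)"
  have lik: "ennreal (likelihood psi p L k n (snd w) D) = ennreal (?g w) * ennreal c" for w
    unfolding likelihood_eq[of psi p L k n _ D \<eta>0] c_def[symmetric]
    using c by (subst mult.commute) (rule ennreal_mult'', simp)
  have "(\<integral>\<^sup>+w. ennreal (likelihood psi p L k n (snd w) D) \<partial>nn_prior L k lam)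
      = (\<integral>\<^sup>+w. ennreal (?g w) \<partial>nn_prior L k lam) * ennreal c"
    unfolding lik using meas by (intro nn_integral_multc) auto
  then show ?thesis
    unfolding nn_posterior_def lik using c by (simp add: divide_mult_eq)
qed

text \<open>The finite-sample form of the result. V stands for the objective value of the competitor
  and \<tau> for the Markov threshold; both stay free, so that they can later be scaled with n while
  c is fixed.\<close>

lemma contraction_fixed_n:
  assumes psi: "psi \<in> borel_measurable borel" and k: "k 0 = p" "k (Suc L) = 1"
    and lam: "\<forall>l\<le>L. 0 \<le> lam l \<and> lam l \<le> 1"
    and eta0: "\<eta>0 \<in> borel_measurable (restrict_space (input_space p) (unit_cube p))"
    and n: "1 \<le> n" and c: "0 < c" "c \<le> 1"
    and q: "q \<in> mean_field L k"
    and V: "kl_div q (nn_prior L k lam)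
       + of_nat n * (\<integral>\<^sup>+w. kl_div (reg_model p \<eta>0) (reg_model p (dnn psi L k (snd w))) \<partial>q) \<le> ennreal V" "0 \<le> V"
    and tau: "0 < \<tau>"
  shows "\<exists>B\<in>sets (sample_law n (reg_model p \<eta>0)).
    measure (sample_law n (reg_model p \<eta>0)) B \<le> exp (- real n * (c ^ 4 / 32)) + (V + 3) / \<tau> \<and>
    (\<forall>D\<in>space (data_space p n) - B. \<forall>Q'\<in>mean_field L k.
       kl_div Q' (nn_posterior psi p L k lam n D) \<le> kl_div q (nn_posterior psi p L k lam n D) \<longrightarrow>
       real n * (c ^ 4 / 32) * outer_prob (distr Q' (param_space L k) snd)
         {\<theta>\<in>space (param_space L k). c < hellinger (obs_space p) (reg_density p \<eta>0) (reg_density p (dnn psi L k \<theta>))}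
         \<le> V + \<tau>)"
proof -
  \<comment> \<open>outside the cube nothing is known about \<open>\<eta>0\<close>, so it is replaced by 0 there\<close>
  define e0 where "e0 x = indicator (unit_cube p) x *\<^sub>R \<eta>0 x" for x
  have e0[measurable]: "e0 \<in> borel_measurable (input_space p)"
    using eta0 borel_measurable_restrict_space_iff[of "unit_cube p" "input_space p" \<eta>0]
    unfolding e0_def by simp
  have reg: "reg_density p \<eta>0 = reg_density p e0"
    by (auto simp: fun_eq_iff reg_density_eq e0_def indicator_def)
  have mod: "reg_model p \<eta>0 = reg_model p e0" by (simp add: reg_model_def reg)
  define P0 where "P0 = reg_model p e0"
  define T where "T = nn_prior L k lam"
  define \<rho> where "\<rho> b = ratio e0 (dnn psi L k (snd b))" for b :: "nodes \<times> params"
  define dH where "dH \<theta> = hellinger (obs_space p) (reg_density p \<eta>0) (reg_density p (dnn psi L k \<theta>))" for \<theta>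
  define \<Theta> where "\<Theta> = {\<theta>\<in>space (param_space L k). c < dH \<theta>}"
  define A where "A = snd -` \<Theta> \<inter> space T"
  \<comment> \<open>Chosen so that 1 / sqrt 2 - 2 d = (1 - c^2) / sqrt 2, the mean of the kernel
    guaranteed beyond distance c. Then d^2 / 4 = c^4 / 32.\<close>
  define d where "d = c\<^sup>2 / (2 * sqrt 2)"
  interpret P0: prob_space P0 unfolding P0_def by (rule prob_space_reg_model) measurable
  interpret T: prob_space T unfolding T_def by (rule prob_space_nn_prior[OF lam])
  interpret q: prob_space q by (rule mean_fieldD(1)[OF q])
  interpret I: sigma_finite_measure "input_space p" by (rule sigma_finite_input_space)
  interpret O: sigma_finite_measure "obs_space p" by (rule sigma_finite_obs_space)
  have setsT[measurable_cong]: "sets T = sets (count_space (indicator_set L k) \<Otimes>\<^sub>M param_space L k)"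
    unfolding T_def sets_nn_prior joint_space_def ..
  have spT: "space T = indicator_set L k \<times> space (param_space L k)"
    using sets_eq_imp_space_eq[OF setsT] by (simp add: space_pair_measure)
  have setsP0[measurable_cong]: "sets P0 = sets (lborel \<Otimes>\<^sub>M input_space p)"
    unfolding P0_def sets_reg_model obs_space_def ..
  have snd_T[measurable]: "snd \<in> measurable T (param_space L k)" by measurable
  have dnn[measurable]: "dnn psi L k \<theta> \<in> borel_measurable (input_space p)"
    if "\<theta> \<in> space (param_space L k)" for \<theta>
    by (rule dnn_measurable_input[OF psi k that])
  note dnn_joint[measurable] = dnn_measurable[OF psi k]
  have Theta[measurable]: "\<Theta> \<in> sets (param_space L k)"
  proof -
    have "(\<lambda>x. dnn psi L k (fst x) (snd (snd x))) \<in> borel_measurable (param_space L k \<Otimes>\<^sub>M obs_space p)"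
    proof -
      have "(\<lambda>x. (fst x, snd (snd x))) \<in> measurable (param_space L k \<Otimes>\<^sub>M obs_space p) (param_space L k \<Otimes>\<^sub>M input_space p)"
        unfolding obs_space_def by measurable
      from measurable_compose[OF this dnn_joint] show ?thesis by simp
    qed
    then have [measurable]: "(\<lambda>x. reg_density p (dnn psi L k (fst x)) (snd x)) \<in> borel_measurable (param_space L k \<Otimes>\<^sub>M obs_space p)"
      unfolding reg_density_def split_beta obs_space_def by measurable
    have [measurable]: "reg_density p e0 \<in> borel_measurable (obs_space p)" by measurable
    have "dH \<in> borel_measurable (param_space L k)"
      unfolding dH_def hellinger_def reg by measurable
    then show ?thesis unfolding \<Theta>_def by measurable
  qed
  have A[measurable]: "A \<in> sets T" unfolding A_def by measurable
  have setsq: "sets q = sets T"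
    unfolding setsT using mean_fieldD(2)[OF q] by (simp add: joint_space_def)
  have klq: "kl_div q T \<le> ennreal V"
    using V(1) unfolding T_def by (rule order_trans[rotated]) simp
  then have "kl_div q T < \<infinity>" by (simp add: le_less_trans)
  then obtain dq where dq: "dq \<in> borel_measurable T" "\<And>b. 0 \<le> dq b" "q = density T (\<lambda>b. ennreal (dq b))"
    "AE b in q. 0 < dq b" "integrable q (\<lambda>b. ln (dq b))" "kl_div q T = ennreal (\<integral>b. ln (dq b) \<partial>q)"
    using kl_div_finiteE[OF T.prob_space_axioms q.finite_measure_axioms] by metis
  have dqV: "(\<integral>b. ln (dq b) \<partial>q) \<le> V" using klq dq(6) V(2) by simp
  define kl where "kl b = kl_div P0 (reg_model p (dnn psi L k (snd b)))" for b :: "nodes \<times> params"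
  have hd: "c\<^sup>2 \<le> 1" "0 < c\<^sup>2" using c by (auto simp: power_le_one)
  have s2: "1 \<le> sqrt 2" by simp
  interpret sm: separated_model P0 T q \<rho> kl dq "residual_kernel e0" A "1 / sqrt 2" d n
  proof
    have "(\<lambda>x. (snd (fst x), snd (snd x))) \<in> measurable (T \<Otimes>\<^sub>M P0) (param_space L k \<Otimes>\<^sub>M input_space p)"
      by measurable
    from measurable_compose[OF this dnn_joint]
    have [measurable]: "(\<lambda>x. dnn psi L k (snd (fst x)) (snd (snd x))) \<in> borel_measurable (T \<Otimes>\<^sub>M P0)" by simp
    show "(\<lambda>(b, a). \<rho> b a) \<in> borel_measurable (T \<Otimes>\<^sub>M P0)"
      unfolding \<rho>_def ratio_def split_beta by measurable
    show "0 < \<rho> b a" for b a by (simp add: \<rho>_def ratio_pos)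
    show "(\<integral>\<^sup>+a. ennreal (\<rho> b a) \<partial>P0) = 1" if "b \<in> space T" for b
      unfolding \<rho>_def P0_def using that by (intro nn_integral_ratio e0 dnn) (auto simp: spT)
    fix b assume b: "b \<in> space T" "kl b < \<infinity>"
    then have "snd b \<in> space (param_space L k)" by (auto simp: spT)
    note kd = kl_div_reg_model[OF e0 dnn[OF this]]
    show "integrable P0 (\<lambda>a. ln (\<rho> b a))" "ennreal (- (\<integral>a. ln (\<rho> b a) \<partial>P0)) \<le> kl b"
      using kd b(2) by (auto simp: \<rho>_def P0_def kl_def)
  next
    show "residual_kernel e0 \<in> borel_measurable P0"
      unfolding P0_def using residual_kernel_measurable[OF e0] by (simp cong: measurable_cong_sets)
    show "0 \<le> residual_kernel e0 a \<and> residual_kernel e0 a \<le> 1" for a by (rule residual_kernel_bounds)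
    show "(\<integral>\<^sup>+a. ennreal (residual_kernel e0 a) \<partial>P0) = ennreal (1 / sqrt 2)"
      unfolding P0_def by (rule nn_integral_kernel[OF e0])
    show "(\<integral>\<^sup>+a. ennreal (\<rho> b a * residual_kernel e0 a) \<partial>P0) \<le> ennreal (1 / sqrt 2 - 2 * d)"
      if "b \<in> A" for b
    proof -
      have b: "snd b \<in> space (param_space L k)" "c < dH (snd b)"
        using that by (auto simp: A_def \<Theta>_def)
      have "1 / sqrt 2 - 2 * d = (1 - c\<^sup>2) / sqrt 2"
        by (simp add: d_def diff_divide_distrib)
      then show ?thesis
        unfolding \<rho>_def P0_def
        using nn_integral_ratio_kernel_le[OF e0 dnn[OF b(1)] less_imp_le[OF c(1)] c(2)] b(2)
        by (simp add: dH_def reg)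
    qed
    show "2 * d \<le> 1 / sqrt 2" using hd by (simp add: d_def divide_right_mono)
    show "0 < d" using hd by (simp add: d_def)
    have "c\<^sup>2 \<le> 2 * (2 * sqrt 2)" using hd(1) s2 by linarith
    then show "d \<le> 2" by (simp add: d_def pos_divide_le_eq)
  qed (use dq A n in auto)
  have kappa: "sm.\<kappa> = c ^ 4 / 32"
    unfolding sm.\<kappa>_def unfolding d_def by (simp add: power_divide power_mult_distrib flip: power_mult)
  have S: "sm.S = sample_law n P0" unfolding sm.S_def sample_law_def ..
  have spS: "space sm.S = space (data_space p n)"
    unfolding sm.S_def data_space_def space_PiM by (simp add: P0_def space_reg_model)
  \<comment> \<open>V bounds a sum of two nonnegative terms, hence each of them: the divergence to
    the prior here gives the V in V + \<tau>, and the expected likelihood term gives the V in V +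
    3.\<close>
  have klK: "(\<integral>\<^sup>+b. kl b \<partial>q) \<le> ennreal (V / real n)"
  proof -
    have "of_nat n * (\<integral>\<^sup>+b. kl b \<partial>q) \<le> ennreal V"
      using V(1) unfolding kl_def P0_def mod by (rule order_trans[rotated]) simp
    then have "ennreal (1 / real n) * (of_nat n * (\<integral>\<^sup>+b. kl b \<partial>q)) \<le> ennreal (1 / real n) * ennreal V"
      by (rule mult_left_mono) simp
    moreover have "ennreal (1 / real n) * of_nat n = 1"
      using n by (simp add: ennreal_of_nat_eq_real_of_nat ennreal_mult'[symmetric])
    ultimately show ?thesis
      by (simp add: mult.assoc[symmetric] ennreal_mult'[symmetric])
  qed
  obtain B1 where B1: "B1 \<in> sets sm.S"
    "measure sm.S B1 \<le> exp (- real n * sm.\<kappa>) + (real n * (V / real n) + 3) / \<tau>"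
    "\<forall>D\<in>space sm.S - B1. \<forall>Q'. prob_space Q' \<longrightarrow> kl_div Q' (sm.posterior D) \<le> kl_div q (sm.posterior D) \<longrightarrow>
       real n * sm.\<kappa> * measure Q' A \<le> (\<integral>b. ln (dq b) \<partial>q) + \<tau>"
    using sm.bad_set[OF klK _ tau] V(2) by auto
  \<comment> \<open>Data with an input off the cube have likelihood 0 for every parameter, so the
    posterior cannot be rewritten by likelihood ratios there. They form a null set and are
    discarded.\<close>
  define B2 where "B2 = {D\<in>space sm.S. \<exists>i<n. snd (D i) \<notin> unit_cube p}"
  have B2m[measurable]: "B2 \<in> sets sm.S"
  proof -
    have "{D\<in>space sm.S. snd (D i) \<in> unit_cube p} \<in> sets sm.S" if "i < n" for i
    proof -
      have [measurable]: "(\<lambda>D. D i) \<in> measurable sm.S (lborel \<Otimes>\<^sub>M input_space p)"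
        using sm.component[OF that] measurable_cong_sets[OF refl setsP0] by blast
      show ?thesis by measurable
    qed
    then have "space sm.S - {D\<in>space sm.S. snd (D i) \<in> unit_cube p} \<in> sets sm.S" if "i < n" for i
      using that by auto
    then have "(\<Union>i<n. space sm.S - {D\<in>space sm.S. snd (D i) \<in> unit_cube p}) \<in> sets sm.S"
      by (intro sets.finite_UN) auto
    also have "(\<Union>i<n. space sm.S - {D\<in>space sm.S. snd (D i) \<in> unit_cube p}) = B2"
      unfolding B2_def by auto
    finally show ?thesis .
  qed
  have "AE D in sm.S. snd (D i) \<in> unit_cube p" if "i < n" for i
    unfolding sm.S_def
  proof (rule AE_PiM_component)
    have "snd z \<in> unit_cube p" if "0 < reg_density p e0 z" for z
      using that by (cases z) (auto simp: reg_density_eq split: split_indicator_asm)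
    then show "AE a in P0. snd a \<in> unit_cube p"
      unfolding P0_def reg_model_def by (subst AE_density) (auto intro!: AE_I2)
  qed (use that P0.prob_space_axioms in auto)
  then have "AE D in sm.S. \<forall>i\<in>{..<n}. snd (D i) \<in> unit_cube p"
    by (subst AE_finite_all) auto
  then have "AE D in sm.S. D \<notin> B2" by eventually_elim (auto simp: B2_def)
  then have "measure sm.S B2 = 0"
    using AE_iff_null_sets[OF B2m] by (intro measure_eq_0_null_sets) simp
  then have "measure sm.S (B1 \<union> B2) \<le> exp (- real n * (c ^ 4 / 32)) + (V + 3) / \<tau>"
    using measure_Un_le[OF B1(1) B2m] B1(2) n by (simp add: kappa)
  moreover have "real n * (c ^ 4 / 32) * outer_prob (distr Q' (param_space L k) snd) \<Theta> \<le> V + \<tau>"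
    if D: "D \<in> space (data_space p n) - (B1 \<union> B2)" and Q': "Q' \<in> mean_field L k"
      and opt: "kl_div Q' (nn_posterior psi p L k lam n D) \<le> kl_div q (nn_posterior psi p L k lam n D)" for D Q'
  proof -
    have D': "D \<in> space sm.S" using D spS by simp
    have cube: "snd (D i) \<in> unit_cube p" if "i < n" for i
      using D D' that by (auto simp: B2_def)
    have "0 < reg_density p e0 (D i)" if "i < n" for i
      using cube[OF that] by (cases "D i") (simp add: reg_density_eq normal_density_pos)
    then have "0 < (\<Prod>i<n. reg_density p e0 (D i))" by (intro prod_pos) auto
    from nn_posterior_eq[OF this, of psi L k lam] sm.LR_meas2[OF D']
    have post: "nn_posterior psi p L k lam n D = sm.posterior D"
      unfolding sm.posterior_def sm.LR_def unfolding \<rho>_def T_def by simp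
    have setsQ': "sets Q' = sets T" 
      unfolding setsT using mean_fieldD(2)[OF Q'] by (simp add: joint_space_def)
    note [measurable_cong] = setsQ'
    have "outer_prob (distr Q' (param_space L k) snd) \<Theta> \<le> measure (distr Q' (param_space L k) snd) \<Theta>"
      by (rule outer_prob_le) auto
    also have "\<dots> = measure Q' (snd -` \<Theta> \<inter> space Q')"
      by (rule measure_distr) measurable
    also have "\<dots> = measure Q' A"
      unfolding A_def sets_eq_imp_space_eq[OF setsQ'] ..
    finally have "real n * sm.\<kappa> * outer_prob (distr Q' (param_space L k) snd) \<Theta> \<le> real n * sm.\<kappa> * measure Q' A"
      by (intro mult_left_mono) (auto simp: kappa)
    also have "\<dots> \<le> (\<integral>b. ln (dq b) \<partial>q) + \<tau>"
      using B1(3) D D' opt mean_fieldD(1)[OF Q'] unfolding post by blast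
    finally show ?thesis using dqV by (simp add: kappa)
  qed
  ultimately show ?thesis
    unfolding mod P0_def[symmetric] S[symmetric] using B1(1) B2m
    by (intro bexI[of _ "B1 \<union> B2"]) (auto simp: \<Theta>_def dH_def mod reg)
qed

section \<open>Consistency\<close>

lemma diagonal_sequence:
  fixes a :: "nat \<Rightarrow> nat \<Rightarrow> real"
  assumes a: "\<And>j. a j \<longlonglongrightarrow> 0" and a0: "\<And>j n. 0 \<le> a j n"
  shows "\<exists>J. filterlim J at_top sequentially \<and> (\<lambda>n. a (J n) n) \<longlonglongrightarrow> 0"
proof -
  define P where "P j n \<longleftrightarrow> a j n \<le> 1 / real (Suc j)" for j n
  have ev: "eventually (P j) sequentially" for j
  proof -
    have "eventually (\<lambda>n. a j n < 1 / real (Suc j)) sequentially"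
      using a[of j] by (rule order_tendstoD) simp
    then show ?thesis by eventually_elim (simp add: P_def)
  qed
  have "\<forall>j. \<exists>N. \<forall>n\<ge>N. P j n"
    using ev by (simp add: eventually_sequentially)
  then obtain N where N: "\<And>j n. N j \<le> n \<Longrightarrow> P j n" by metis
  \<comment> \<open>\<open>J n\<close> will be the largest index whose threshold has been passed.
    The cap j \<le> n keeps the set finite, and admitting j = 0 keeps it nonempty.\<close>
  define K where "K n = {j. j \<le> n \<and> (j = 0 \<or> N j \<le> n)}" for n
  define J where "J n = Max (K n)" for n
  have finK: "finite (K n)" for n unfolding K_def by simp
  have "0 \<in> K n" for n unfolding K_def by simp
  then have JK: "J n \<in> K n" for n
    unfolding J_def using finK by (intro Max_in) auto
  have J: "filterlim J at_top sequentially"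
    unfolding filterlim_at_top eventually_sequentially
  proof
    fix j
    have "j \<le> J n" if "max j (N j) \<le> n" for n
      unfolding J_def using that finK by (intro Max_ge) (auto simp: K_def)
    then show "\<exists>m. \<forall>n\<ge>m. j \<le> J n" by blast
  qed
  moreover have "(\<lambda>n. a (J n) n) \<longlonglongrightarrow> 0"
  proof (rule tendsto_sandwich[OF _ _ tendsto_const])
    \<comment> \<open>Index 0 is the default and carries no bound; from index 1 on, membership
      guarantees that the threshold was passed.\<close>
    have "eventually (\<lambda>n. 1 \<le> J n) sequentially"
      using J by (simp add: filterlim_at_top)
    then show "eventually (\<lambda>n. a (J n) n \<le> 1 / real (Suc (J n))) sequentially"
    proof eventually_elim
      case (elim n)
      then have "N (J n) \<le> n" using JK[of n] by (auto simp: K_def)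
      then have "P (J n) n" by (rule N)
      then show ?case by (simp add: P_def)
    qed
    show "(\<lambda>n. 1 / real (Suc (J n))) \<longlonglongrightarrow> 0"
      using filterlim_compose[OF LIMSEQ_inverse_real_of_nat J] by (simp add: inverse_eq_divide)
  qed (use a0 in auto)
  ultimately show ?thesis by blast
qed

lemma u_term_nonneg:
  assumes "1 \<le> n" "1 \<le> k l" "1 \<le> k (Suc l)"
  shows "0 \<le> u_term L k n l"
  unfolding u_term_def using assms by (intro mult_nonneg_nonneg add_nonneg_nonneg ln_ge_zero) auto

theorem theorem4p4:
  fixes p L :: "nat \<Rightarrow> nat" and k :: "nat \<Rightarrow> nat \<Rightarrow> nat" and psi :: "real \<Rightarrow> real"
    and lam :: "nat \<Rightarrow> nat \<Rightarrow> real" and eta0 :: "nat \<Rightarrow> inp \<Rightarrow> real"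
    and s B :: "nat \<Rightarrow> nat \<Rightarrow> real"
    and qstar :: "nat \<Rightarrow> (nat \<Rightarrow> obs) \<Rightarrow> (nodes \<times> params) measure"
  defines "U \<equiv> \<lambda>n. U_sum (L n) (k n) n"
    and "R \<equiv> \<lambda>n. R_sum (L n) (k n) (s n) (B n) n"
    and "Xi \<equiv> \<lambda>n. approx_err psi (p n) (L n) (k n) (s n) (B n) (eta0 n)"
    and "xi \<equiv> \<lambda>n. xi_val psi (p n) (L n) (k n) (s n) (B n) (eta0 n)"
    and "eps \<equiv> \<lambda>n. eps_rate psi (p n) (L n) (k n) (s n) (B n) (eta0 n) n"
    and "P0 \<equiv> \<lambda>n. reg_model (p n) (eta0 n)"
    and "Pth \<equiv> \<lambda>n \<theta>. reg_model (p n) (dnn psi (L n) (k n) \<theta>)"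
    and "dH \<equiv> \<lambda>n \<theta>. hellinger (obs_space (p n)) (reg_density (p n) (eta0 n))
                                (reg_density (p n) (dnn psi (L n) (k n) \<theta>))"
    and "inF \<equiv> \<lambda>n \<theta>. restrict (dnn psi (L n) (k n) \<theta>) (unit_cube (p n))
                       \<in> sieve psi (p n) (L n) (k n)
                           (s_circ (L n) (k n) n (eps_rate psi (p n) (L n) (k n) (s n) (B n) (eta0 n) n))
                           (B_circ (L n) (k n) n (eps_rate psi (p n) (L n) (k n) (s n) (B n) (eta0 n) n))"
    and "PiT \<equiv> \<lambda>n. distr (nn_prior (L n) (k n) (lam n)) (param_space (L n) (k n)) snd"
  assumes widths: "\<forall>n. 1 \<le> p n \<and> k n 0 = p n \<and> k n (Suc (L n)) = 1 \<and> (\<forall>l\<le>Suc (L n). 1 \<le> k n l)"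
    and psi_lip: "\<forall>a b. \<bar>psi a - psi b\<bar> \<le> \<bar>a - b\<bar>"
    and psi_le: "\<forall>x\<ge>0. psi x \<le> x"
    and lam: "\<forall>n. lam n (L n) = 1 \<and> (\<forall>l\<le>L n. 0 \<le> lam n l \<and> lam n l \<le> 1)"
    and eta0_meas: "\<forall>n. eta0 n \<in> borel_measurable (restrict_space (input_space (p n)) (unit_cube (p n)))"
    and B_pos: "\<forall>n. \<forall>l\<le>L n. 0 < B n l"
    and rate1: "(\<lambda>n. ereal (R n) + Xi n) \<longlonglongrightarrow> 0"
    and rate2: "filterlim (\<lambda>n. real n * (R n + xi n)) at_top sequentially"
    and eps1: "eps \<longlonglongrightarrow> 0"
    and eps2: "filterlim (\<lambda>n. real n * (eps n)\<^sup>2) at_top sequentially"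
    and tests: "\<exists>C1>0. \<exists>C2>0. \<forall>\<^sub>F n in sequentially. \<exists>\<phi>.
        \<phi> \<in> borel_measurable (data_space (p n) n)
      \<and> (\<forall>D\<in>space (data_space (p n) n). 0 \<le> \<phi> D \<and> \<phi> D \<le> 1)
      \<and> (\<integral>D. \<phi> D \<partial>sample_law n (P0 n)) \<le> exp (- C1 * real n * (eps n)\<^sup>2)
      \<and> (\<forall>\<theta>\<in>space (param_space (L n) (k n)). dH n \<theta> > eps n \<and> inF n \<theta> \<longrightarrow>
            (\<integral>D. 1 - \<phi> D \<partial>sample_law n (Pth n \<theta>)) \<le> exp (- C2 * real n * (dH n \<theta>)\<^sup>2))"
    and prior_mass: "\<exists>C3>0. \<forall>\<^sub>F n in sequentially.
        outer_prob (PiT n) {\<theta> \<in> space (param_space (L n) (k n)). \<not> inF n \<theta>}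
          \<le> exp (- C3 * real n * (eps n)\<^sup>2 / U n)"
    and kl_cond: "\<exists>C4>0. \<exists>C5>0. \<forall>\<^sub>F n in sequentially.
        measure (PiT n) {\<theta> \<in> space (param_space (L n) (k n)).
                           kl_div (P0 n) (Pth n \<theta>) < ennreal (R n + xi n)}
          \<ge> exp (- C4 * real n * (R n + xi n))
      \<and> (\<exists>q\<in>mean_field (L n) (k n).
           kl_div q (nn_prior (L n) (k n) (lam n))
           + of_nat n * (\<integral>\<^sup>+ w. kl_div (P0 n) (Pth n (snd w)) \<partial>q)
           \<le> ennreal (C5 * real n * (R n + xi n)))"
    and qstar_opt: "\<forall>n. \<forall>D\<in>space (data_space (p n) n).
        qstar n D \<in> mean_field (L n) (k n)
      \<and> (\<forall>q\<in>mean_field (L n) (k n).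
           kl_div (qstar n D) (nn_posterior psi (p n) (L n) (k n) (lam n) n D)
             \<le> kl_div q (nn_posterior psi (p n) (L n) (k n) (lam n) n D))"
  shows "\<exists>M :: nat \<Rightarrow> real. filterlim M at_top sequentially
      \<and> (\<lambda>n. M n * eps n) \<longlonglongrightarrow> 0
      \<and> (\<forall>\<delta>>0. (\<lambda>n. outer_prob (sample_law n (P0 n))
              {D \<in> space (data_space (p n) n).
                 outer_prob (distr (qstar n D) (param_space (L n) (k n)) snd)
                   {\<theta> \<in> space (param_space (L n) (k n)). dH n \<theta> > M n * eps n} > \<delta>})
           \<longlonglongrightarrow> 0)"
proof -
  obtain C4 C5 where C5: "0 < C5" and ev: "\<forall>\<^sub>F n in sequentially.
        measure (PiT n) {\<theta> \<in> space (param_space (L n) (k n)).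
                           kl_div (P0 n) (Pth n \<theta>) < ennreal (R n + xi n)}
          \<ge> exp (- C4 * real n * (R n + xi n))
      \<and> (\<exists>q\<in>mean_field (L n) (k n).
           kl_div q (nn_prior (L n) (k n) (lam n))
           + of_nat n * (\<integral>\<^sup>+ w. kl_div (P0 n) (Pth n (snd w)) \<partial>q)
           \<le> ennreal (C5 * real n * (R n + xi n)))"
    using kl_cond by blast
  define r where "r n = R n + xi n" for n
  have q_ev: "\<forall>\<^sub>F n in sequentially. \<exists>q\<in>mean_field (L n) (k n).
           kl_div q (nn_prior (L n) (k n) (lam n))
           + of_nat n * (\<integral>\<^sup>+ w. kl_div (P0 n) (Pth n (snd w)) \<partial>q)
           \<le> ennreal (C5 * real n * r n)"
    using ev unfolding r_def by eventually_elim blast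
  \<comment> \<open>\<open>Xi\<close> is an extended real and \<open>xi\<close> its real part, which
    defaults to 0 at infinity. The limit forces \<open>Xi\<close> to be finite from some n on, and
    then the two agree.\<close>
  have r0: "r \<longlonglongrightarrow> 0"
  proof -
    have "\<forall>\<^sub>F n in sequentially. ereal (R n) + Xi n < 1" "\<forall>\<^sub>F n in sequentially. ereal (R n) + Xi n > -1"
      using order_tendstoD[OF rate1] by simp_all
    then have "\<forall>\<^sub>F n in sequentially. ereal (R n) + Xi n = ereal (r n)"
    proof eventually_elim
      case (elim n)
      then have "Xi n \<noteq> \<infinity>" "Xi n \<noteq> -\<infinity>" by auto
      moreover have "xi n = real_of_ereal (Xi n)" by (simp add: Xi_def xi_def xi_val_def)
      ultimately have "Xi n = ereal (xi n)" by (cases "Xi n") simp_all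
      then show ?case by (simp add: r_def)
    qed
    then have "(\<lambda>n. ereal (r n)) \<longlonglongrightarrow> ereal 0"
      by (rule Lim_transform_eventually[OF rate1[unfolded zero_ereal_def]])
    then show ?thesis by (simp only: lim_ereal)
  qed
  have r_pos: "\<forall>\<^sub>F n in sequentially. 0 < r n"
  proof -
    have "\<forall>\<^sub>F n in sequentially. 1 \<le> real n * (R n + xi n)"
      using rate2 by (simp add: filterlim_at_top)
    then show ?thesis
      by eventually_elim (auto simp: r_def zero_less_mult_iff dest!: less_le_trans[OF zero_less_one])
  qed
  \<comment> \<open>The real square root is odd, so the sign of \<open>eps\<close> has to be
    derived: both factors under the root are nonnegative for large n, and the growth of n
    \<open>eps\<close>^2 excludes 0.\<close>
  have eps_pos: "\<forall>\<^sub>F n in sequentially. 0 < eps n"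
  proof -
    have "\<forall>\<^sub>F n in sequentially. 1 \<le> real n * (eps n)\<^sup>2"
      using eps2 by (simp add: filterlim_at_top)
    with r_pos eventually_ge_at_top[of 1] show ?thesis
    proof eventually_elim
      case (elim n)
      have "0 \<le> U n" unfolding U_def U_sum_def
        using widths elim(2) by (intro sum_nonneg u_term_nonneg) auto
      then have "0 \<le> eps n"
        using elim(1) unfolding eps_def eps_rate_def r_def R_def xi_def U_def by simp
      moreover have "eps n \<noteq> 0" using elim(3) by auto
      ultimately show ?case by simp
    qed
  qed
  have psi: "psi \<in> borel_measurable borel" by (rule lipschitz_borel_measurable[OF psi_lip])
  define far where "far n c D = outer_prob (distr (qstar n D) (param_space (L n) (k n)) snd)
                   {\<theta> \<in> space (param_space (L n) (k n)). dH n \<theta> > c}" for n c D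
  have fixed: "(\<lambda>n. outer_prob (sample_law n (P0 n)) {D \<in> space (data_space (p n) n). far n c D > \<delta>}) \<longlonglongrightarrow> 0"
    if c: "0 < c" "c \<le> 1" and \<delta>: "0 < \<delta>" for c \<delta>
  proof -
    define \<kappa> where "\<kappa> = c ^ 4 / 32"
    have kap: "0 < \<kappa>" using c by (simp add: \<kappa>_def)
    \<comment> \<open>This is exp (- n \<kappa>) + (C5 n r + 3) / \<tau> for \<tau> = \<delta> n
      \<kappa> / 2, sorted by its three vanishing parts.\<close>
    define bnd where "bnd n = exp (- \<kappa>) ^ n + 2 * C5 / (\<delta> * \<kappa>) * r n + 6 / (\<delta> * \<kappa>) * (1 / real n)" for n
    have "bnd \<longlonglongrightarrow> 0 + 2 * C5 / (\<delta> * \<kappa>) * 0 + 6 / (\<delta> * \<kappa>) * 0"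
      unfolding bnd_def using kap
      by (intro tendsto_intros r0 LIMSEQ_power_zero lim_1_over_n) auto
    then have bnd0: "bnd \<longlonglongrightarrow> 0" by simp
    \<comment> \<open>With this threshold the competitor costs at most a quarter of n \<kappa>
      \<delta>. Since \<tau> is half of it, the sum stays strictly below n \<kappa> \<delta>, which
      a far mass above \<delta> would contradict.\<close>
    have small: "\<forall>\<^sub>F n in sequentially. r n < \<delta> * \<kappa> / (4 * C5)"
      using r0 by (rule order_tendstoD) (use kap \<delta> C5 in simp)
    have "\<forall>\<^sub>F n in sequentially.
        outer_prob (sample_law n (P0 n)) {D \<in> space (data_space (p n) n). far n c D > \<delta>} \<le> bnd n"
      using q_ev small r_pos eventually_ge_at_top[of 1]
    proof eventually_elim
      case (elim n)
      obtain q where q: "q \<in> mean_field (L n) (k n)" "kl_div q (nn_prior (L n) (k n) (lam n))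
           + of_nat n * (\<integral>\<^sup>+ w. kl_div (P0 n) (Pth n (snd w)) \<partial>q) \<le> ennreal (C5 * real n * r n)"
        using elim(1) by blast
      define \<tau> where "\<tau> = \<delta> * real n * \<kappa> / 2"
      have tau: "0 < \<tau>" using \<delta> kap elim(4) by (simp add: \<tau>_def)
      have V0: "0 \<le> C5 * real n * r n" using C5 elim(3) by simp
      have w: "k n 0 = p n" "k n (Suc (L n)) = 1" "\<forall>l\<le>L n. 0 \<le> lam n l \<and> lam n l \<le> 1"
        using widths lam by auto
      have "\<exists>B\<in>sets (sample_law n (P0 n)).
          measure (sample_law n (P0 n)) B \<le> exp (- real n * \<kappa>) + (C5 * real n * r n + 3) / \<tau> \<and>
          (\<forall>D\<in>space (data_space (p n) n) - B. \<forall>Q'\<in>mean_field (L n) (k n).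
             kl_div Q' (nn_posterior psi (p n) (L n) (k n) (lam n) n D)
               \<le> kl_div q (nn_posterior psi (p n) (L n) (k n) (lam n) n D) \<longrightarrow>
             real n * \<kappa> * outer_prob (distr Q' (param_space (L n) (k n)) snd)
               {\<theta> \<in> space (param_space (L n) (k n)). c < dH n \<theta>} \<le> C5 * real n * r n + \<tau>)"
        unfolding \<kappa>_def P0_def dH_def
        by (rule contraction_fixed_n[OF psi w eta0_meas[rule_format] elim(4) c q(1)
            q(2)[unfolded P0_def Pth_def] V0 tau])
      then obtain B where B: "B \<in> sets (sample_law n (P0 n))"
        "measure (sample_law n (P0 n)) B \<le> exp (- real n * \<kappa>) + (C5 * real n * r n + 3) / \<tau>"
        "\<forall>D\<in>space (data_space (p n) n) - B. \<forall>Q'\<in>mean_field (L n) (k n).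
             kl_div Q' (nn_posterior psi (p n) (L n) (k n) (lam n) n D)
               \<le> kl_div q (nn_posterior psi (p n) (L n) (k n) (lam n) n D) \<longrightarrow>
             real n * \<kappa> * outer_prob (distr Q' (param_space (L n) (k n)) snd)
               {\<theta> \<in> space (param_space (L n) (k n)). c < dH n \<theta>} \<le> C5 * real n * r n + \<tau>"
        by blast
      have sub: "{D \<in> space (data_space (p n) n). far n c D > \<delta>} \<subseteq> B"
      proof (rule subsetI, rule ccontr)
        fix D assume D: "D \<in> {D \<in> space (data_space (p n) n). far n c D > \<delta>}" "D \<notin> B"
        have "real n * \<kappa> * far n c D \<le> C5 * real n * r n + \<tau>"
          unfolding far_def by (rule B(3)[rule_format]) (use D q(1) qstar_opt in auto)
        moreover have "real n * \<kappa> * \<delta> < real n * \<kappa> * far n c D"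
          using D kap elim(4) by simp
        moreover have "C5 * real n * r n \<le> real n * (\<delta> * \<kappa>) / 4"
        proof -
          have "C5 * r n \<le> \<delta> * \<kappa> / 4"
            using elim(2) C5 by (simp add: field_simps)
          then have "real n * (C5 * r n) \<le> real n * (\<delta> * \<kappa> / 4)" by (rule mult_left_mono) simp
          then show ?thesis by (simp add: mult_ac)
        qed
        moreover have "0 < real n * (\<delta> * \<kappa>)" using elim(4) kap \<delta> by simp
        ultimately show False by (simp add: \<tau>_def mult_ac)
      qed
      have "outer_prob (sample_law n (P0 n)) {D \<in> space (data_space (p n) n). far n c D > \<delta>}
          \<le> measure (sample_law n (P0 n)) B"
        by (rule outer_prob_le[OF B(1)]) (use sub in blast)
      also note B(2)
      also have "exp (- real n * \<kappa>) + (C5 * real n * r n + 3) / \<tau> = bnd n"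
        using elim(4) kap \<delta> by (simp add: bnd_def \<tau>_def exp_of_nat_mult[symmetric] field_simps)
      finally show ?case .
    qed
    then show ?thesis
      by (intro tendsto_sandwich[OF _ _ tendsto_const bnd0]) (auto simp: outer_prob_nonneg)
  qed
  \<comment> \<open>Radius and level share one index, so a single diagonal sequence eventually
    handles every level \<delta>.\<close>
  define a where "a j n = outer_prob (sample_law n (P0 n))
     {D \<in> space (data_space (p n) n). far n (1 / real (Suc j)) D > 1 / real (Suc j)}" for j n
  have "a j \<longlonglongrightarrow> 0" for j unfolding a_def by (rule fixed) auto
  moreover have "0 \<le> a j n" for j n unfolding a_def by (rule outer_prob_nonneg)
  ultimately obtain J where J: "filterlim J at_top sequentially" "(\<lambda>n. a (J n) n) \<longlonglongrightarrow> 0"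
    using diagonal_sequence by blast
  have J0: "(\<lambda>n. 1 / real (Suc (J n))) \<longlonglongrightarrow> 0"
    using filterlim_compose[OF LIMSEQ_inverse_real_of_nat J(1)] by (simp add: inverse_eq_divide)
  \<comment> \<open>The first entry keeps the radius M \<open>eps\<close> at least 1 / (J + 1),
    where the diagonal bound applies. The second forces M to infinity however fast J grows, and
    still lets M \<open>eps\<close> tend to 0.\<close>
  define M where "M n = max (1 / real (Suc (J n)) / eps n) (1 / sqrt (eps n))" for n
  have Meps: "\<forall>\<^sub>F n in sequentially. M n * eps n = max (1 / real (Suc (J n))) (sqrt (eps n))"
    using eps_pos
  proof eventually_elim
    case (elim n)
    have "1 / sqrt (eps n) * eps n = sqrt (eps n)"
      using elim by (simp add: real_div_sqrt)
    then show ?case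
      using elim by (simp add: M_def max_mult_distrib_right)
  qed
  show ?thesis
  proof (intro exI[of _ M] conjI allI impI)
    have "filterlim (\<lambda>n. inverse (sqrt (eps n))) at_top sequentially"
    proof (rule filterlim_inverse_at_top)
      show "(\<lambda>n. sqrt (eps n)) \<longlonglongrightarrow> 0" using tendsto_real_sqrt[OF eps1] by simp
      show "\<forall>\<^sub>F n in sequentially. 0 < sqrt (eps n)" using eps_pos by simp
    qed
    then show "filterlim M at_top sequentially"
      by (rule filterlim_at_top_mono) (simp add: M_def inverse_eq_divide)
    have "(\<lambda>n. max (1 / real (Suc (J n))) (sqrt (eps n))) \<longlonglongrightarrow> max 0 0"
      using J0 tendsto_real_sqrt[OF eps1] by (intro tendsto_max) auto
    then show "(\<lambda>n. M n * eps n) \<longlonglongrightarrow> 0"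
      using Meps by (subst tendsto_cong[OF Meps]) simp
    fix \<delta> :: real assume \<delta>: "0 < \<delta>"
    have "\<forall>\<^sub>F n in sequentially. 1 / real (Suc (J n)) < \<delta>"
      using J0 \<delta> by (rule order_tendstoD)
    then have "\<forall>\<^sub>F n in sequentially.
       outer_prob (sample_law n (P0 n)) {D \<in> space (data_space (p n) n). far n (M n * eps n) D > \<delta>} \<le> a (J n) n"
      using Meps
    proof eventually_elim
      case (elim n)
      have far_le: "far n (M n * eps n) D \<le> far n (1 / real (Suc (J n))) D" for D
        unfolding far_def elim(2) by (rule outer_prob_mono) auto
      have "1 / real (Suc (J n)) < far n (1 / real (Suc (J n))) D" if "\<delta> < far n (M n * eps n) D" for D
        using elim(1) that far_le[of D] by linarith
      then show ?case unfolding a_def by (intro outer_prob_mono) blast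
    qed
    then have "(\<lambda>n. outer_prob (sample_law n (P0 n)) {D \<in> space (data_space (p n) n). far n (M n * eps n) D > \<delta>}) \<longlonglongrightarrow> 0"
      by (intro tendsto_sandwich[OF _ _ tendsto_const J(2)]) (auto simp: outer_prob_nonneg)
    then show "(\<lambda>n. outer_prob (sample_law n (P0 n))
              {D \<in> space (data_space (p n) n).
                 outer_prob (distr (qstar n D) (param_space (L n) (k n)) snd)
                   {\<theta> \<in> space (param_space (L n) (k n)). dH n \<theta> > M n * eps n} > \<delta>})
           \<longlonglongrightarrow> 0" unfolding far_def .
  qed
qed

end
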